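(* Let $(\bar A,\bar B)$ be an irreducible structural pair, where $\bar A\in\{0,\star\}^{n\times n}$ is symmetrically structured and $\bar B\in\{0,\star\}^{n\times m}$ is structured. Then the generic dimension of the controllable subspace of $(\bar A,\bar B)$ equals $\textrm{t-rank}([\bar A,\bar B])$, the term rank of the concatenation of the matrices $\bar A$ and $\bar B$.
   Context: A structured matrix $\bar M\in\{0,\star\}^{n\times m}$ is a matrix each of whose entries is either a fixed zero or an independent free real parameter $\star$. A matrix in $\{0,\star\}^{n\times n}$ is symmetrically structured if its pattern is symmetric and the free parameters at positions $(i,j)$ and $(j,i)$ are constrained to be equal. A numerical realization $\tilde M$ assigns real numbers to the $\star$-parameters; $\mathbf p_{\tilde M}\in\mathbb R^{n_{\bar M}}$ is the vector of values of the $n_{\bar M}$ independent parameters. $(\bar A,\bar B)$ is irreducible if there is no permutation matrix $P$ and no $0\le p<n$ such that $P\bar AP^\top=\begin{bmatrix}\bar A_{11}&\mathbf 0\\ \mathbf 0&\bar A_{22}\end{bmatrix}$ and $P\bar B=\begin{bmatrix}\bar B_1\\ \mathbf 0\end{bmatrix}$ with $\bar A_{11}\in\{0,\star\}^{p\times p}$, $\bar B_1\in\{0,\star\}^{p\times m}$. A variety in $\mathbb R^N$ is the common zero set of finitely many polynomials; it is proper if it is not all of $\mathbb R^N$. The generic dimension of the controllable subspace of $(\bar A,\bar B)$ is the integer $d_c$ for which there is a proper variety $V\subset\mathbb R^{n_{\bar A}+n_{\bar B}}$ such that $\operatorname{rank}[\tilde B,\tilde A\tilde B,\dots,\tilde A^{n-1}\tilde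 B]=d_c$ for every numerical realization $(\tilde A,\tilde B)$ with $[\mathbf p_{\tilde A},\mathbf p_{\tilde B}]\notin V$. The term rank $\textrm{t-rank}(\bar M)$ is the largest $k$ such that there are distinct rows $i_1,\dots,i_k$ and distinct columns $j_1,\dots,j_k$ with $[\bar M]_{i_\ell j_\ell}=\star$ for all $\ell$. *)

theory Defs
  imports
    "Jordan_Normal_Form.DL_Rank"
    "HOL-Library.Poly_Mapping"
    "HOL-Library.FuncSet"
    "HOL-Combinatorics.Permutations"
begin

section \<open>Structured matrices\<close>

datatype entry = Fixed_Zero | Star

text \<open>The \<open>zero\<close> instance makes the library's zero blocks \<open>0\<^sub>m\<close> available for patterns.\<close>

instantiation entry :: zero
begin
definition zero_entry :: entry where "zero_entry = Fixed_Zero"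
instance ..
end

text \<open>The pattern of a symmetrically structured matrix. That the parameters at \<open>(i,j)\<close> and
  \<open>(j,i)\<close> coincide is expressed by \<open>sym_realization\<close> and \<open>params\<close> below.\<close>

definition sym_pattern :: "entry mat \<Rightarrow> bool" where
  "sym_pattern A \<longleftrightarrow> transpose_mat A = A"

definition realization :: "entry mat \<Rightarrow> real mat \<Rightarrow> bool" where
  "realization M M' \<longleftrightarrow> M' \<in> carrier_mat (dim_row M) (dim_col M) \<and>
     (\<forall>i<dim_row M. \<forall>j<dim_col M. M $$ (i,j) = Fixed_Zero \<longrightarrow> M' $$ (i,j) = 0)"

definition sym_realization :: "entry mat \<Rightarrow> real mat \<Rightarrow> bool" where
  "sym_realization M M' \<longleftrightarrow> realization M M' \<and> transpose_mat M' = M'"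

definition append_cols :: "'a mat \<Rightarrow> 'a mat \<Rightarrow> 'a mat" where
  "append_cols A B = mat_of_cols (dim_row A) (cols A @ cols B)"

definition t_rank :: "entry mat \<Rightarrow> nat" where
  "t_rank M = Max {k. \<exists>r c. inj_on r {..<k} \<and> inj_on c {..<k} \<and>
     (\<forall>l<k. r l < dim_row M \<and> c l < dim_col M \<and> M $$ (r l, c l) = Star)}"


section \<open>Irreducibility\<close>

text \<open>If \<open>P\<close> is the permutation matrix with a \<open>1\<close> at the positions \<open>(i, \<pi> i)\<close>, then these
  are \<open>P M P\<^sup>T\<close> and \<open>P M\<close>.\<close>

definition permute_both :: "(nat \<Rightarrow> nat) \<Rightarrow> 'a mat \<Rightarrow> 'a mat" where
  "permute_both \<pi> M = mat (dim_row M) (dim_col M) (\<lambda>(i,j). M $$ (\<pi> i, \<pi> j))"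

definition permute_rows :: "(nat \<Rightarrow> nat) \<Rightarrow> 'a mat \<Rightarrow> 'a mat" where
  "permute_rows \<pi> M = mat (dim_row M) (dim_col M) (\<lambda>(i,j). M $$ (\<pi> i, j))"

definition irreducible_pair :: "entry mat \<Rightarrow> entry mat \<Rightarrow> bool" where
  "irreducible_pair A B \<longleftrightarrow> (let n = dim_row A; m = dim_col B in
     \<not> (\<exists>\<pi> p A11 A22 B1. \<pi> permutes {..<n} \<and> p < n \<and>
          A11 \<in> carrier_mat p p \<and> A22 \<in> carrier_mat (n - p) (n - p) \<and> B1 \<in> carrier_mat p m \<and>
          permute_both \<pi> A = four_block_mat A11 (0\<^sub>m p (n - p)) (0\<^sub>m (n - p) p) A22 \<and>
          permute_rows \<pi> B = B1 @\<^sub>r 0\<^sub>m (n - p) m))"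


section \<open>Parameters\<close>

text \<open>Independent parameters are named by matrix positions, \<open>Inl\<close> for \<open>A\<close> and \<open>Inr\<close> for \<open>B\<close>.
  A position \<open>(i,j)\<close> of the symmetric \<open>A\<close> and its mirror image share one parameter, named by
  the position with \<open>i \<le> j\<close>. The parameter space is the space of real vectors indexed by
  \<open>params A B\<close>, represented by extensional functions.\<close>

type_synonym param = "(nat \<times> nat) + (nat \<times> nat)"

definition params :: "entry mat \<Rightarrow> entry mat \<Rightarrow> param set" where
  "params A B =
     Inl ` {(i,j). i \<le> j \<and> j < dim_col A \<and> A $$ (i,j) = Star} \<union>
     Inr ` {(i,j). i < dim_row B \<and> j < dim_col B \<and> B $$ (i,j) = Star}"

definition param_vec :: "entry mat \<Rightarrow> entry mat \<Rightarrow> real mat \<Rightarrow> real mat \<Rightarrow> param \<Rightarrow> real" where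
  "param_vec A B A' B' = restrict (case_sum (\<lambda>ij. A' $$ ij) (\<lambda>ij. B' $$ ij)) (params A B)"


section \<open>Varieties\<close>

type_synonym 'v rpoly = "('v \<Rightarrow>\<^sub>0 nat) \<Rightarrow>\<^sub>0 real"

definition rpoly_vars :: "'v rpoly \<Rightarrow> 'v set" where
  "rpoly_vars f = (\<Union>mon\<in>Poly_Mapping.keys f. Poly_Mapping.keys mon)"

definition rpoly_eval :: "'v rpoly \<Rightarrow> ('v \<Rightarrow> real) \<Rightarrow> real" where
  "rpoly_eval f x = (\<Sum>mon\<in>Poly_Mapping.keys f.
     Poly_Mapping.lookup f mon * (\<Prod>v\<in>Poly_Mapping.keys mon. x v ^ Poly_Mapping.lookup mon v))"

definition coord_space :: "'v set \<Rightarrow> ('v \<Rightarrow> real) set" where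
  "coord_space I = I \<rightarrow>\<^sub>E UNIV"

definition variety :: "'v set \<Rightarrow> ('v \<Rightarrow> real) set \<Rightarrow> bool" where
  "variety I V \<longleftrightarrow> (\<exists>F :: 'v rpoly set. finite F \<and> (\<forall>f\<in>F. rpoly_vars f \<subseteq> I) \<and>
     V = {x \<in> coord_space I. \<forall>f\<in>F. rpoly_eval f x = 0})"

definition proper_variety :: "'v set \<Rightarrow> ('v \<Rightarrow> real) set \<Rightarrow> bool" where
  "proper_variety I V \<longleftrightarrow> variety I V \<and> V \<noteq> coord_space I"


section \<open>Generic dimension of the controllable subspace\<close>

definition ctrl_mat :: "real mat \<Rightarrow> real mat \<Rightarrow> real mat" where
  "ctrl_mat A B = mat_of_cols (dim_row A)
     (concat (map (\<lambda>k. cols (A ^\<^sub>m k * B)) [0..<dim_row A]))"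

definition is_generic_ctrl_dim :: "entry mat \<Rightarrow> entry mat \<Rightarrow> nat \<Rightarrow> bool" where
  "is_generic_ctrl_dim A B d \<longleftrightarrow> (\<exists>V. proper_variety (params A B) V \<and>
     (\<forall>A' B'. sym_realization A A' \<and> realization B B' \<and> param_vec A B A' B' \<notin> V \<longrightarrow>
        vec_space.rank (dim_row A) (ctrl_mat A' B') = d))"

definition generic_ctrl_dim :: "entry mat \<Rightarrow> entry mat \<Rightarrow> nat" where
  "generic_ctrl_dim A B = (THE d. is_generic_ctrl_dim A B d)"

end

theory Submission
  imports Defs "HOL-Combinatorics.Cycles"
begin

text \<open>For every realization the controllable subspace lies in the column space of \<open>[A, B]\<close>, whose
  dimension is at most the term rank; so it suffices to find one point at which a suitable
  polynomial does not vanish. Let \<open>r\<close> be the term rank of \<open>A\<close>. A maximum matching of \<open>A\<close> gives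
  disjoint cycles covering at least \<open>r\<close> vertices (an unmatched path splits into 2-cycles because \<open>A\<close> is
  symmetric). Starting from the inputs, irreducibility lets us attach these cycles, and the
  remaining vertices, one after the other. If the edge to a new cycle is first taken directed and the
  weights of the cycle are scaled by \<open>s \<rightarrow> \<infinity>\<close>, the Krylov vectors separate the new cycle from
  the old part. Conjugation by \<open>diag(1, t)\<close> turns a symmetric edge of weight \<open>t\<close> into a directed edge
  of weight \<open>1\<close> with a back edge of weight \<open>t\<^sup>2\<close>, so a small \<open>t\<close> restores symmetry. Hence generically
  \<open>A\<close> times the controllable subspace has dimension at least \<open>r \<ge> rank A\<close>, so it is the
  column space of \<open>A\<close>, and the controllable subspace is the column space of \<open>[A, B]\<close>. The
  generic rank of \<open>[A, B]\<close> is its term rank, again by a decomposition into cycles and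
  input edges.\<close>

section \<open>Minors\<close>

definition minor :: "nat \<Rightarrow> (nat \<Rightarrow> nat \<Rightarrow> real) \<Rightarrow> real" where
  "minor r F = det (mat r r (\<lambda>(i,j). F i j))"

lemma minor_Leibniz:
  "minor r F = (\<Sum>p | p permutes {0..<r}. signof p * (\<Prod>i=0..<r. F i (p i)))"
proof -
  have "minor r F = (\<Sum>p | p permutes {0..<r}.
      signof p * (\<Prod>i=0..<r. mat r r (\<lambda>(i,j). F i j) $$ (i, p i)))"
    unfolding minor_def by (rule det_def') auto
  also have "\<dots> = (\<Sum>p | p permutes {0..<r}. signof p * (\<Prod>i=0..<r. F i (p i)))"
  proof (intro sum.cong refl arg_cong2[of _ _ _ _ "(*)"] prod.cong)
    fix p i assume "p \<in> {p. p permutes {0..<r}}" "i \<in> {0..<r}"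
    then have "p i < r" "i < r" using permutes_in_image[of p "{0..<r}" i] by auto
    then show "mat r r (\<lambda>(i,j). F i j) $$ (i, p i) = F i (p i)" by simp
  qed
  finally show ?thesis .
qed

lemma minor_cong:
  assumes "\<And>i j. i < r \<Longrightarrow> j < r \<Longrightarrow> F i j = G i j"
  shows "minor r F = minor r G"
  unfolding minor_def by (intro arg_cong[of _ _ det] cong_mat) (use assms in auto)

lemma tendsto_minor:
  assumes "\<And>i j. i < r \<Longrightarrow> j < r \<Longrightarrow> ((\<lambda>t. F t i j) \<longlongrightarrow> G i j) net"
  shows "((\<lambda>t. minor r (F t)) \<longlongrightarrow> minor r G) net"
  unfolding minor_Leibniz
proof (intro tendsto_sum tendsto_mult tendsto_const tendsto_prod)
  fix p i assume "p \<in> {p. p permutes {0..<r}}" "i \<in> {0..<r}"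
  then have "p i < r" "i < r" using permutes_in_image[of p "{0..<r}" i] by auto
  then show "((\<lambda>t. F t i (p i)) \<longlongrightarrow> G i (p i)) net" using assms by auto
qed

lemma minor_scale:
  "minor r (\<lambda>i j. a i * b j * F i j) = (\<Prod>i=0..<r. a i) * (\<Prod>j=0..<r. b j) * minor r F"
proof -
  have "signof p * (\<Prod>i=0..<r. a i * b (p i) * F i (p i)) =
     (\<Prod>i=0..<r. a i) * (\<Prod>j=0..<r. b j) * (signof p * (\<Prod>i=0..<r. F i (p i)))"
    if "p permutes {0..<r}" for p
  proof -
    have "(\<Prod>i=0..<r. b (p i)) = (\<Prod>j=0..<r. b j)"
      using prod.permute[OF that, of b] by (simp add: comp_def)
    then show ?thesis by (simp add: prod.distrib)
  qed
  then show ?thesis unfolding minor_Leibniz sum_distrib_left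
    by (intro sum.cong) auto
qed

lemma minor_block:
  "minor (r + p) (\<lambda>i j. if i < r \<and> j < r then G i j else if r \<le> i \<and> r \<le> j then H (i - r) (j - r) else 0)
    = minor r G * minor p H"
proof -
  have "mat (r + p) (r + p) (\<lambda>(i,j). if i < r \<and> j < r then G i j else if r \<le> i \<and> r \<le> j then H (i - r) (j - r) else 0)
    = four_block_mat (mat r r (\<lambda>(i,j). G i j)) (0\<^sub>m r p) (0\<^sub>m p r) (mat p p (\<lambda>(i,j). H i j))"
    by (rule eq_matI) auto
  then show ?thesis unfolding minor_def
    by (simp add: det_four_block_mat_upper_right_zero[of _ r _ p])
qed

lemma minor_mult:
  "minor r (\<lambda>i j. \<Sum>l<r. F i l * G l j) = minor r F * minor r G"
proof -
  have "mat r r (\<lambda>(i,j). \<Sum>l<r. F i l * G l j) = mat r r (\<lambda>(i,j). F i j) * mat r r (\<lambda>(i,j). G i j)"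
    by (rule eq_matI) (auto simp: scalar_prod_def atLeast0LessThan)
  then show ?thesis unfolding minor_def by (simp add: det_mult[of _ r])
qed

lemma minor_unitriangular:
  assumes "\<And>i j. j < i \<Longrightarrow> i < r \<Longrightarrow> F i j = 0" "\<And>i. i < r \<Longrightarrow> F i i = 1"
  shows "minor r F = 1"
proof -
  have "minor r F = prod_list (diag_mat (mat r r (\<lambda>(i,j). F i j)))"
    unfolding minor_def
    by (rule det_upper_triangular[where n = r]) (use assms in \<open>auto simp: upper_triangular_def\<close>)
  also have "\<dots> = 1"
    unfolding prod_list_diag_prod by (rule prod.neutral) (use assms in auto)
  finally show ?thesis .
qed

lemma minor_transpose: "minor r (\<lambda>i j. F j i) = minor r F"
proof -
  have "mat r r (\<lambda>(i,j). F j i) = transpose_mat (mat r r (\<lambda>(i,j). F i j))"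
    by (rule eq_matI) auto
  then show ?thesis unfolding minor_def by (simp add: det_transpose[of _ r])
qed

lemma minor_eq_0_iff:
  "minor r F = 0 \<longleftrightarrow> (\<exists>v. (\<exists>i<r. v i \<noteq> 0) \<and> (\<forall>i<r. (\<Sum>j<r. F i j * v j) = 0))"
proof -
  let ?M = "mat r r (\<lambda>(i,j). F i j)"
  have M: "?M \<in> carrier_mat r r" by simp
  have mv: "(?M *\<^sub>v vec r v) $ i = (\<Sum>j<r. F i j * v j)" if "i < r" for i v
    using that by (simp add: scalar_prod_def atLeast0LessThan)
  have "minor r F = 0 \<longleftrightarrow> (\<exists>v. v \<in> carrier_vec r \<and> v \<noteq> 0\<^sub>v r \<and> ?M *\<^sub>v v = 0\<^sub>v r)"
    unfolding minor_def using det_0_iff_vec_prod_zero[OF M] .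
  also have "\<dots> \<longleftrightarrow> (\<exists>v. (\<exists>i<r. v i \<noteq> 0) \<and> (\<forall>i<r. (\<Sum>j<r. F i j * v j) = 0))" (is "?L = ?R")
  proof
    assume ?L
    then obtain w where w: "w \<in> carrier_vec r" "w \<noteq> 0\<^sub>v r" "?M *\<^sub>v w = 0\<^sub>v r" by blast
    have e: "vec r (\<lambda>i. w $ i) = w" using w(1) by auto
    have "\<exists>i<r. w $ i \<noteq> 0" using w(1,2) by (metis eq_vecI carrier_vecD index_zero_vec(1,2))
    moreover have "\<forall>i<r. (\<Sum>j<r. F i j * w $ j) = 0"
      using mv[of _ "\<lambda>i. w $ i", unfolded e] w(3) by auto
    ultimately show ?R by (intro exI[of _ "\<lambda>i. w $ i"]) blast
  next
    assume ?R
    then obtain v i where v: "i < r" "v i \<noteq> 0" "\<forall>i<r. (\<Sum>j<r. F i j * v j) = 0" by blast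
    have "vec r v \<noteq> 0\<^sub>v r" using v(1,2) by (metis index_vec index_zero_vec(1))
    moreover have "?M *\<^sub>v vec r v = 0\<^sub>v r"
      by (rule eq_vecI) (use mv v(3) in auto)
    ultimately show ?L by (intro exI[of _ "vec r v"]) auto
  qed
  finally show ?thesis .
qed

lemma minor_matching:
  assumes "minor r F \<noteq> 0"
  obtains p where "p permutes {0..<r}" "\<And>i. i < r \<Longrightarrow> F i (p i) \<noteq> 0"
proof -
  have "\<exists>p. p permutes {0..<r} \<and> (\<forall>i<r. F i (p i) \<noteq> 0)"
  proof (rule ccontr)
    assume *: "\<not> ?thesis"
    have "minor r F = 0" unfolding minor_Leibniz
    proof (rule sum.neutral, intro ballI)
      fix p assume p: "p \<in> {p. p permutes {0..<r}}"
      then obtain i where "i < r" "F i (p i) = 0" using * by blast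
      then have "(\<Prod>i=0..<r. F i (p i)) = 0" by (intro prod_zero) auto
      then show "signof p * (\<Prod>i=0..<r. F i (p i)) = 0" by simp
    qed
    then show False using assms by simp
  qed
  then show ?thesis using that by blast
qed

lemma minor_inj_rows:
  assumes "minor r (\<lambda>i j. F (c i) j) \<noteq> 0"
  shows "inj_on c {..<r}"
proof (rule ccontr)
  assume "\<not> inj_on c {..<r}"
  then obtain i j where ij: "i < r" "j < r" "i \<noteq> j" "c i = c j"
    unfolding inj_on_def by auto
  have "det (mat r r (\<lambda>(i,j). F (c i) j)) = 0"
    by (rule det_identical_rows[of _ r i j]) (use ij in \<open>auto simp: row_def\<close>)
  then show False using assms unfolding minor_def by simp
qed

section \<open>Walks and weighted cycles\<close>

primrec walk :: "'a set \<Rightarrow> ('a \<Rightarrow> 'a \<Rightarrow> real) \<Rightarrow> nat \<Rightarrow> 'a \<Rightarrow> 'a \<Rightarrow> real" where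
  "walk S M 0 u i = of_bool (i = u)"
| "walk S M (Suc k) u i = (\<Sum>j\<in>S. M i j * walk S M k u j)"

lemma walk_conj:
  assumes "\<And>i j. i \<in> S \<Longrightarrow> j \<in> S \<Longrightarrow> M i j * d j = d i * N i j" and "i \<in> S"
  shows "walk S M k u i * d u = d i * walk S N k u i"
  using assms(2)
proof (induction k arbitrary: i)
  case 0
  then show ?case by simp
next
  case (Suc k)
  have "walk S M (Suc k) u i * d u = (\<Sum>j\<in>S. M i j * (walk S M k u j * d u))"
    by (simp add: sum_distrib_right mult.assoc)
  also have "\<dots> = (\<Sum>j\<in>S. (M i j * d j) * walk S N k u j)"
    using Suc.IH by (intro sum.cong) (auto simp: mult.assoc)
  also have "\<dots> = (\<Sum>j\<in>S. d i * (N i j * walk S N k u j))"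
    using assms(1) Suc.prems by (intro sum.cong) (auto simp: mult.assoc)
  finally show ?case by (simp add: sum_distrib_left)
qed

lemma tendsto_walk:
  assumes "\<And>i j. ((\<lambda>t. M t i j) \<longlongrightarrow> N i j) net"
  shows "((\<lambda>t. walk S (M t) k u i) \<longlongrightarrow> walk S N k u i) net"
proof (induction k arbitrary: i)
  case (Suc k)
  then show ?case unfolding walk.simps by (intro tendsto_intros assms)
qed simp

lemma walk_bij:
  assumes z: "bij_betw z S Y" and M: "\<And>i j. i \<in> S \<Longrightarrow> j \<in> S \<Longrightarrow> M (z i) (z j) = Q i j"
    and "s \<in> S" "i \<in> S"
  shows "walk Y M k (z s) (z i) = walk S Q k s i"
  using assms(4)
proof (induction k arbitrary: i)
  case 0
  then show ?case using z assms(3) by (auto simp: bij_betw_def inj_on_def)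
next
  case (Suc k)
  have "walk Y M (Suc k) (z s) (z i) = (\<Sum>j\<in>S. M (z i) (z j) * walk Y M k (z s) (z j))"
    unfolding walk.simps by (rule sum.reindex_bij_betw[OF z, symmetric])
  also have "\<dots> = walk S Q (Suc k) s i"
    unfolding walk.simps using Suc M by (intro sum.cong) auto
  finally show ?case .
qed

text \<open>A path with unit weights whose ends are joined by an edge of weight \<open>d\<close>. For \<open>d = 0\<close> the end \<open>0\<close>
  generates the whole space; an odd cycle needs a (small) \<open>d \<noteq> 0\<close> to be nonsingular.\<close>

definition cyc_wt :: "nat \<Rightarrow> real \<Rightarrow> nat \<Rightarrow> nat \<Rightarrow> real" where
  "cyc_wt p d i j = of_bool (Suc i = j) + of_bool (Suc j = i) +
     d * (of_bool (i = 0 \<and> Suc j = p) + of_bool (Suc i = p \<and> j = 0))"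

lemma cyc_wt_sym: "cyc_wt p d i j = cyc_wt p d j i"
  unfolding cyc_wt_def by (auto simp: algebra_simps)

lemma cyc_wt_sum:
  assumes "j < p"
  shows "(\<Sum>i<p. cyc_wt p d j i * v i) = (if 0 < j then v (j - 1) else 0) +
    (if Suc j < p then v (Suc j) else 0) +
    d * ((if j = 0 then v (p - 1) else 0) + (if Suc j = p then v 0 else 0))"
proof -
  have delta: "(\<Sum>i<p. of_bool (P \<and> i = k) * v i) = (if P \<and> k < p then v k else 0)" for P k
    by (cases P) (auto simp: of_bool_def if_distrib[of "\<lambda>x. x * _"] sum.delta cong: if_cong)
  have "(\<Sum>i<p. cyc_wt p d j i * v i) =
    (\<Sum>i<p. of_bool (True \<and> i = Suc j) * v i + of_bool (0 < j \<and> i = j - 1) * v i +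
      (d * (of_bool (j = 0 \<and> i = p - 1) * v i) + d * (of_bool (Suc j = p \<and> i = 0) * v i)))"
    using assms by (intro sum.cong) (auto simp: cyc_wt_def algebra_simps of_bool_def)
  then show ?thesis using assms
    unfolding sum.distrib sum_distrib_left[symmetric] delta by auto
qed

lemma cyc_wt_kernel:
  assumes eqs: "\<And>j. j < p \<Longrightarrow> (\<Sum>i<p. cyc_wt p d j i * v i) = 0"
    and d: "even p \<Longrightarrow> d = 0" "odd p \<Longrightarrow> d \<noteq> 0"
    and "i < p"
  shows "v i = 0"
proof -
  have step: "v (Suc (Suc j)) = - v j" if "Suc (Suc j) < p" for j
    using eqs[of "Suc j"] cyc_wt_sum[of "Suc j" p d v] that by auto
  have ev: "v (2 * k) = (-1) ^ k * v 0" if "2 * k < p" for k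
    using that
  proof (induction k)
    case (Suc k)
    then show ?case using step[of "2 * k"] by simp
  qed simp
  have od: "v (2 * k + 1) = (-1) ^ k * v 1" if "2 * k + 1 < p" for k
    using that
  proof (induction k)
    case (Suc k)
    then show ?case using step[of "2 * k + 1"] by simp
  qed simp
  have first: "(if 1 < p then v 1 else 0) + d * (v (p - 1) + (if p = 1 then v 0 else 0)) = 0"
    using eqs[of 0] cyc_wt_sum[of 0 p d v] assms(4) by auto
  have last: "1 < p \<Longrightarrow> v (p - 2) + d * v 0 = 0"
    using eqs[of "p - 1"] cyc_wt_sum[of "p - 1" p d v] assms(4) by (auto simp: numeral_2_eq_2)
  have "v 0 = 0 \<and> (1 < p \<longrightarrow> v 1 = 0)"
  proof (cases "even p")
    case True
    then obtain m where m: "p = 2 * m" by blast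
    with assms(4) obtain m' where m': "m = Suc m'" by (cases m) auto
    have "v (p - 2) = (-1) ^ m' * v 0" using ev[of m'] m m' by simp
    then show ?thesis using first last d(1) True m m' by auto
  next
    case False
    then obtain m where m: "p = 2 * m + 1" by (elim oddE)
    show ?thesis
    proof (cases m)
      case 0
      then show ?thesis using first d(2) False m by simp
    next
      case (Suc m')
      have "v (p - 1) = (-1) ^ m * v 0" using ev[of m] m by simp
      moreover have "v (p - 2) = (-1) ^ m' * v 1" using od[of m'] m Suc by simp
      ultimately have e: "v 1 = (-1) ^ m' * (d * v 0)" "(-1) ^ m' * v 1 = - (d * v 0)"
        using first last m Suc by auto
      have "(-1) ^ m' * v 1 = ((-1) ^ m' * (-1) ^ m') * (d * v 0)" unfolding e(1) by simp
      also have "\<dots> = d * v 0" by (simp flip: power_add mult_2)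
      finally have "d * v 0 = 0" using e(2) by simp
      then show ?thesis using d(2) False e(1) by simp
    qed
  qed
  then have "v 0 = 0" "1 < p \<Longrightarrow> v 1 = 0" by auto
  show ?thesis
  proof (cases "even i")
    case True
    then obtain k where "i = 2 * k" by blast
    then show ?thesis using ev[of k] assms(4) \<open>v 0 = 0\<close> by simp
  next
    case False
    then obtain k where "i = 2 * k + 1" by (elim oddE)
    then show ?thesis using od[of k] assms(4) \<open>1 < p \<Longrightarrow> v 1 = 0\<close> by simp
  qed
qed

lemma cyc_wt_krylov:
  assumes "0 < p"
  obtains d where "even p \<Longrightarrow> d = 0" "minor p (cyc_wt p d) \<noteq> 0"
    "\<And>K. minor p (\<lambda>i l. walk {..<p} (cyc_wt p d) (K + l) 0 i) \<noteq> 0"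
proof -
  let ?W = "\<lambda>d K i l. walk {..<p} (cyc_wt p d) (K + l) 0 i"
  have tri: "walk {..<p} (cyc_wt p 0) l 0 i = of_bool (i = l)" if "l \<le> i" "i < p" for l i
    using that
  proof (induction l arbitrary: i)
    case (Suc l)
    have "(\<Sum>j<p. cyc_wt p 0 i j * walk {..<p} (cyc_wt p 0) l 0 j) =
      walk {..<p} (cyc_wt p 0) l 0 (i - 1) +
      (if Suc i < p then walk {..<p} (cyc_wt p 0) l 0 (Suc i) else 0)"
      using Suc.prems by (subst cyc_wt_sum) auto
    then show ?case using Suc by auto
  qed simp
  have W0: "minor p (?W 0 0) = 1"
    by (rule minor_unitriangular) (use tri in auto)
  have "\<exists>d. (even p \<longrightarrow> d = 0) \<and> (odd p \<longrightarrow> d \<noteq> 0) \<and> minor p (?W d 0) \<noteq> 0"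
  proof (cases "even p")
    case True
    then show ?thesis using W0 by (intro exI[of _ 0]) simp
  next
    case False
    have "((\<lambda>d. minor p (?W d 0)) \<longlongrightarrow> minor p (?W 0 0)) (at_right 0)"
      unfolding cyc_wt_def by (intro tendsto_minor tendsto_walk tendsto_intros) 
    then have "\<forall>\<^sub>F d in at_right 0. minor p (?W d 0) \<noteq> 0"
      by (rule tendsto_imp_eventually_ne) (use W0 in simp)
    moreover have "\<forall>\<^sub>F d in at_right (0::real). d > 0" by (rule eventually_at_right_less)
    ultimately have "\<forall>\<^sub>F d in at_right 0. minor p (?W d 0) \<noteq> 0 \<and> d > 0"
      by eventually_elim simp
    then obtain d where "minor p (?W d 0) \<noteq> 0 \<and> d > 0"
      using eventually_happens'[OF trivial_limit_at_right_real] by blast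
    then show ?thesis using False by (intro exI[of _ d]) auto
  qed
  then obtain d where d: "even p \<Longrightarrow> d = 0" "odd p \<Longrightarrow> d \<noteq> 0" "minor p (?W d 0) \<noteq> 0" by blast
  have Q: "minor p (cyc_wt p d) \<noteq> 0"
    unfolding minor_eq_0_iff using cyc_wt_kernel[of p d] d by blast
  have "minor p (?W d K) \<noteq> 0" for K
  proof (induction K)
    case (Suc K)
    have "minor p (?W d (Suc K)) = minor p (cyc_wt p d) * minor p (?W d K)"
      by (simp flip: minor_mult)
    then show ?case using Suc Q by simp
  qed (use d in simp)
  then show ?thesis using that d Q by blast
qed

definition cycle_set :: "('a \<Rightarrow> 'a \<Rightarrow> bool) \<Rightarrow> 'a set \<Rightarrow> bool" where
  "cycle_set E Y \<longleftrightarrow> (\<forall>y\<in>Y. \<exists>z. bij_betw z {..<card Y} Y \<and> z 0 = y \<and>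
     (\<forall>i<card Y. E (z i) (z (Suc i mod card Y))))"

lemma cycle_set_weights:
  assumes "cycle_set E Y" "finite Y" "y \<in> Y" "\<And>i j. i \<in> Y \<Longrightarrow> j \<in> Y \<Longrightarrow> E i j \<Longrightarrow> E j i"
  shows "\<exists>A z. (\<forall>i j. A i j = A j i) \<and> (\<forall>i j. A i j \<noteq> 0 \<longrightarrow> i \<in> Y \<and> j \<in> Y \<and> E i j) \<and>
    bij_betw z {..<card Y} Y \<and> minor (card Y) (\<lambda>i j. A (z i) (z j)) \<noteq> 0 \<and>
    (\<forall>K. minor (card Y) (\<lambda>i l. walk Y A (K + l) y (z i)) \<noteq> 0)"
proof -
  let ?p = "card Y"
  have p: "0 < ?p" using assms(2,3) by (auto simp: card_gt_0_iff)
  obtain z where z: "bij_betw z {..<?p} Y" "z 0 = y" "\<And>i. i < ?p \<Longrightarrow> E (z i) (z (Suc i mod ?p))"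
    using assms(1,3) unfolding cycle_set_def by blast
  obtain d where d: "even ?p \<Longrightarrow> d = 0" "minor ?p (cyc_wt ?p d) \<noteq> 0"
    "\<And>K. minor ?p (\<lambda>i l. walk {..<?p} (cyc_wt ?p d) (K + l) 0 i) \<noteq> 0"
    using cyc_wt_krylov[OF p] by metis
  define w where "w = inv_into {..<?p} z"
  have wz: "w (z i) = i" if "i < ?p" for i
    unfolding w_def using z(1) that by (auto simp: bij_betw_def)
  have w: "w i < ?p" "z (w i) = i" if "i \<in> Y" for i
    unfolding w_def using z(1) that
    using inv_into_into[of i z "{..<?p}"] by (auto simp: bij_betw_def f_inv_into_f)
  have zY: "z i \<in> Y" if "i < ?p" for i using z(1) that by (auto simp: bij_betw_def)
  define A where "A i j = (if i \<in> Y \<and> j \<in> Y then cyc_wt ?p d (w i) (w j) else 0)" for i j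
  have AQ: "A (z i) (z j) = cyc_wt ?p d i j" if "i < ?p" "j < ?p" for i j
    using that zY wz by (simp add: A_def)
  have e1: "E (z i) (z (Suc i))" if "Suc i < ?p" for i using z(3)[of i] that by simp
  have e2: "E (z i) (z 0)" if "Suc i = ?p" for i using z(3)[of i] that by simp
  have sym: "A i j = A j i" for i j by (auto simp: A_def cyc_wt_sym)
  have supp: "i \<in> Y \<and> j \<in> Y \<and> E i j" if "A i j \<noteq> 0" for i j
  proof -
    have ij: "i \<in> Y" "j \<in> Y" "cyc_wt ?p d (w i) (w j) \<noteq> 0"
      using that by (auto simp: A_def split: if_splits)
    have "Suc (w i) = w j \<or> Suc (w j) = w i \<or> w i = 0 \<and> Suc (w j) = ?p \<or> Suc (w i) = ?p \<and> w j = 0"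
      using ij(3) by (auto simp: cyc_wt_def of_bool_def split: if_splits)
    then have "E (z (w i)) (z (w j)) \<or> E (z (w j)) (z (w i))"
      using e1[of "w i"] e1[of "w j"] e2[of "w i"] e2[of "w j"] w(1)[OF ij(1)] w(1)[OF ij(2)] by auto
    then show ?thesis using assms(4) ij w(2) by metis
  qed
  have ns: "minor ?p (\<lambda>i j. A (z i) (z j)) \<noteq> 0"
      using d(2) minor_cong[of ?p "\<lambda>i j. A (z i) (z j)" "cyc_wt ?p d"] AQ by simp
  have kry: "minor ?p (\<lambda>i l. walk Y A (K + l) y (z i)) \<noteq> 0" for K
  proof -
    have "walk Y A (K + l) y (z i) = walk {..<?p} (cyc_wt ?p d) (K + l) 0 i" if "i < ?p" for i l
      using walk_bij[OF z(1), of A "cyc_wt ?p d" 0 i "K + l"] AQ that z(2) by auto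
    then have "minor ?p (\<lambda>i l. walk Y A (K + l) y (z i)) =
        minor ?p (\<lambda>i l. walk {..<?p} (cyc_wt ?p d) (K + l) 0 i)"
      by (intro minor_cong)
    then show ?thesis using d(3)[of K] by simp
  qed
  show ?thesis
    by (intro exI[of _ A] exI[of _ z]) (use sym supp z(1) ns kry in blast)
qed

section \<open>Growing a network block by block\<close>

lemma tendsto_divide_power_at_top: "((\<lambda>s::real. c / s ^ Suc k) \<longlongrightarrow> 0) at_top"
  by (intro tendsto_divide_0[OF tendsto_const] filterlim_at_top_imp_at_infinity
      filterlim_pow_at_top filterlim_ident) simp

text \<open>\<open>M\<close> lives outside the block \<open>Y\<close>, \<open>s A\<close> inside it, and a single directed edge leads from \<open>x\<close> to
  \<open>y \<in> Y\<close>. Walks of length \<open>k\<close> into \<open>Y\<close> are \<open>o(s\<^sup>k)\<close>, whereas late walks through the first visit of \<open>x\<close>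
  grow as the Krylov vectors of \<open>A\<close>; so the late columns dominate the rows in \<open>Y\<close>.\<close>

locale cascade =
  fixes S Y :: "'a set" and M A :: "'a \<Rightarrow> 'a \<Rightarrow> real" and x y :: 'a
  assumes finite_S: "finite S" and block: "Y \<subseteq> S" "y \<in> Y" and attach: "x \<in> S" "x \<notin> Y"
    and supp_M: "\<And>i j. M i j \<noteq> 0 \<Longrightarrow> i \<notin> Y \<and> j \<notin> Y"
    and supp_A: "\<And>i j. A i j \<noteq> 0 \<Longrightarrow> i \<in> Y \<and> j \<in> Y"
begin

definition casc :: "real \<Rightarrow> 'a \<Rightarrow> 'a \<Rightarrow> real" where
  "casc s i j = M i j + of_bool (i = y \<and> j = x) + s * A i j"

lemma walk_casc_old:
  assumes "i \<notin> Y"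
  shows "walk S (casc s) k u i = walk S M k u i"
  using assms
proof (induction k arbitrary: i)
  case (Suc k)
  have "casc s i j = M i j" for j
    using supp_A[of i j] block Suc.prems by (auto simp: casc_def)
  moreover have "M i j * walk S (casc s) k u j = M i j * walk S M k u j" for j
    using Suc.IH[of j] supp_M[of i j] by (cases "j \<in> Y") auto
  ultimately have "casc s i j * walk S (casc s) k u j = M i j * walk S M k u j" for j
    by metis
  then show ?case by simp
qed simp

lemma walk_casc_new:
  assumes "i \<in> Y"
  shows "walk S (casc s) (Suc k) u i =
    of_bool (i = y) * walk S M k u x + s * (\<Sum>j\<in>Y. A i j * walk S (casc s) k u j)"
proof -
  let ?w = "walk S (casc s) k u"
  have M0: "M i j = 0" for j using supp_M assms by blast
  have "walk S (casc s) (Suc k) u i =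
      (\<Sum>j\<in>S. (if j = x then of_bool (i = y) * ?w j else 0) + s * (A i j * ?w j))"
    using M0 by (auto simp: casc_def algebra_simps intro!: sum.cong)
  also have "\<dots> = of_bool (i = y) * ?w x + s * (\<Sum>j\<in>S. A i j * ?w j)"
    using finite_S attach by (simp add: sum.distrib sum_distrib_left)
  also have "(\<Sum>j\<in>S. A i j * ?w j) = (\<Sum>j\<in>Y. A i j * ?w j)"
    using finite_S block supp_A by (intro sum.mono_neutral_right) auto
  finally show ?thesis using walk_casc_old[OF attach(2)] by simp
qed

lemma walk_casc_new_scaled:
  assumes "i \<in> Y" "s > 0"
  shows "walk S (casc s) (Suc k) u i / s ^ Suc l =
    of_bool (i = y) * walk S M k u x / s ^ Suc l + (\<Sum>j\<in>Y. A i j * (walk S (casc s) k u j / s ^ l))"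
proof -
  have "s * (\<Sum>j\<in>Y. A i j * walk S (casc s) k u j) / s ^ Suc l =
      (\<Sum>j\<in>Y. A i j * (walk S (casc s) k u j / s ^ l))"
    using assms(2) by (simp add: sum_divide_distrib)
  then show ?thesis unfolding walk_casc_new[OF assms(1)] add_divide_distrib by simp
qed

lemma walk_casc_bound:
  assumes "i \<in> Y" "u \<notin> Y"
  shows "((\<lambda>s. walk S (casc s) k u i / s ^ k) \<longlongrightarrow> 0) at_top"
  using assms(1)
proof (induction k arbitrary: i)
  case 0
  then show ?case using assms(2) by auto
next
  case (Suc k)
  have "((\<lambda>s. of_bool (i = y) * walk S M k u x / s ^ Suc k +
      (\<Sum>j\<in>Y. A i j * (walk S (casc s) k u j / s ^ k))) \<longlongrightarrow> 0 + (\<Sum>j\<in>Y. A i j * 0)) at_top"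
    by (intro tendsto_add tendsto_divide_power_at_top tendsto_sum tendsto_mult tendsto_const Suc.IH)
  moreover have "\<forall>\<^sub>F s in at_top. of_bool (i = y) * walk S M k u x / s ^ Suc k +
      (\<Sum>j\<in>Y. A i j * (walk S (casc s) k u j / s ^ k)) = walk S (casc s) (Suc k) u i / s ^ Suc k"
    using eventually_gt_at_top[of 0] by eventually_elim (rule walk_casc_new_scaled[OF Suc.prems, symmetric])
  ultimately show ?case by (auto intro: Lim_transform_eventually)
qed

lemma walk_casc_unreached:
  assumes "\<And>k. k < q \<Longrightarrow> walk S M k u x = 0" "u \<notin> Y" "k \<le> q" "i \<in> Y"
  shows "walk S (casc s) k u i = 0"
  using assms(3,4)
proof (induction k arbitrary: i)
  case 0
  then show ?case using assms(2) by auto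
next
  case (Suc k)
  then show ?case unfolding walk_casc_new[OF Suc.prems(2)] using assms(1)[of k] by simp
qed

lemma walk_casc_limit:
  assumes "\<And>k. k < q \<Longrightarrow> walk S M k u x = 0" "u \<notin> Y" "i \<in> Y"
  shows "((\<lambda>s. walk S (casc s) (Suc q + k) u i / s ^ k) \<longlongrightarrow> walk S M q u x * walk Y A k y i) at_top"
  using assms(3)
proof (induction k arbitrary: i)
  case 0
  have "walk S (casc s) (Suc q) u i = of_bool (i = y) * walk S M q u x" for s
    unfolding walk_casc_new[OF 0] using walk_casc_unreached[OF assms(1,2)] by simp
  then show ?case by simp
next
  case (Suc k)
  have "((\<lambda>s. of_bool (i = y) * walk S M (Suc q + k) u x / s ^ Suc k +
      (\<Sum>j\<in>Y. A i j * (walk S (casc s) (Suc q + k) u j / s ^ k)))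
      \<longlongrightarrow> 0 + (\<Sum>j\<in>Y. A i j * (walk S M q u x * walk Y A k y j))) at_top"
    by (intro tendsto_add tendsto_divide_power_at_top tendsto_sum tendsto_mult[of "\<lambda>_. A i _"] tendsto_const Suc.IH)
  moreover have "\<forall>\<^sub>F s in at_top. of_bool (i = y) * walk S M (Suc q + k) u x / s ^ Suc k +
      (\<Sum>j\<in>Y. A i j * (walk S (casc s) (Suc q + k) u j / s ^ k))
      = walk S (casc s) (Suc q + Suc k) u i / s ^ Suc k"
    using eventually_gt_at_top[of 0] unfolding add_Suc_right
    by eventually_elim (rule walk_casc_new_scaled[OF Suc.prems, symmetric])
  moreover have "0 + (\<Sum>j\<in>Y. A i j * (walk S M q u x * walk Y A k y j)) = walk S M q u x * walk Y A (Suc k) y i"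
    by (simp add: sum_distrib_left mult.left_commute)
  ultimately show ?case by (auto intro: Lim_transform_eventually)
qed

lemma eventually_minor_casc:
  assumes old: "minor r (\<lambda>i l. walk S M (\<kappa> l) (\<mu> l) (c i)) \<noteq> 0"
    and c: "\<And>i. i < r \<Longrightarrow> c i \<notin> Y" and \<mu>: "\<And>i. i < r \<Longrightarrow> \<mu> i \<notin> Y"
    and new: "\<And>K. minor p (\<lambda>i l. walk Y A (K + l) y (z i)) \<noteq> 0"
    and z: "\<And>i. i < p \<Longrightarrow> z i \<in> Y"
    and q: "\<And>k. k < q \<Longrightarrow> walk S M k u x = 0" "walk S M q u x \<noteq> 0" and u: "u \<notin> Y"
  shows "\<exists>d. \<forall>\<^sub>F s in at_top. minor (r + p) (\<lambda>i l. walk S (casc s)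
      (if l < r then \<kappa> l else Suc q + (d + 2 + (l - r))) (if l < r then \<mu> l else u)
      (if i < r then c i else z (i - r))) \<noteq> 0"
proof -
  define d where "d = Suc (\<Sum>l<r. \<kappa> l)"
  define \<kappa>' where "\<kappa>' l = (if l < r then \<kappa> l else Suc q + (d + 2 + (l - r)))" for l
  define \<mu>' where "\<mu>' l = (if l < r then \<mu> l else u)" for l
  define c' where "c' i = (if i < r then c i else z (i - r))" for i
  define a where "a s i = (if i < r then 1 else 1 / s ^ d)" for s :: real and i
  define b where "b s l = (if l < r then 1 else 1 / s ^ (2 + (l - r)))" for s :: real and l
  let ?F = "\<lambda>s i l. walk S (casc s) (\<kappa>' l) (\<mu>' l) (c' i)"
  let ?G = "\<lambda>i l. walk S M (\<kappa> l) (\<mu> l) (c i)"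
  let ?H = "\<lambda>i l. walk S M q u x * 1 * walk Y A (d + 2 + l) y (z i)"
  let ?L = "\<lambda>i j. if i < r \<and> j < r then ?G i j else if r \<le> i \<and> r \<le> j then ?H (i - r) (j - r) else 0"
  have lim: "((\<lambda>s. a s i * b s l * ?F s i l) \<longlongrightarrow> ?L i l) at_top" if il: "i < r + p" "l < r + p" for i l
  proof (cases "i < r")
    case i: True
    show ?thesis
    proof (cases "l < r")
      case True
      then show ?thesis using i c by (simp add: a_def b_def c'_def \<kappa>'_def \<mu>'_def walk_casc_old)
    next
      case False
      have "((\<lambda>s. walk S M (\<kappa>' l) (\<mu>' l) (c i) / s ^ Suc (Suc (l - r))) \<longlongrightarrow> 0) at_top"
        by (rule tendsto_divide_power_at_top)
      then show ?thesis using i c False by (simp add: a_def b_def c'_def walk_casc_old)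
    qed
  next
    case i: False
    then have zi: "z (i - r) \<in> Y" using z il by simp
    show ?thesis
    proof (cases "l < r")
      case True
      then have "\<kappa> l \<le> (\<Sum>l<r. \<kappa> l)" by (intro member_le_sum) auto
      then obtain e where e: "d = \<kappa> l + Suc e" unfolding d_def using le_Suc_ex by auto
      have "((\<lambda>s. walk S (casc s) (\<kappa> l) (\<mu> l) (z (i - r)) / s ^ \<kappa> l * (1 / s ^ Suc e)) \<longlongrightarrow> 0 * 0) at_top"
        using \<mu> True by (intro tendsto_mult walk_casc_bound tendsto_divide_power_at_top zi) auto
      then show ?thesis using i True
        by (simp add: a_def b_def c'_def \<kappa>'_def \<mu>'_def e power_add mult_ac)
    next
      case False
      let ?k = "d + 2 + (l - r)"
      have eq: "a s i * b s l * ?F s i l = walk S (casc s) (Suc q + ?k) u (z (i - r)) / s ^ ?k" for s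
      proof -
        obtain l' where "l = r + l'" using False le_Suc_ex[of r l] by auto
        then show ?thesis
          using i by (simp add: a_def b_def c'_def \<kappa>'_def \<mu>'_def power_add mult_ac del: walk.simps)
      qed
      have "((\<lambda>s. walk S (casc s) (Suc q + ?k) u (z (i - r)) / s ^ ?k) \<longlongrightarrow>
          walk S M q u x * walk Y A ?k y (z (i - r))) at_top"
        using walk_casc_limit[of q u "z (i - r)" ?k] q(1) u zi by blast
      then show ?thesis unfolding eq using i False by (simp del: walk.simps)
    qed
  qed
  have "((\<lambda>s. minor (r + p) (\<lambda>i l. a s i * b s l * ?F s i l)) \<longlongrightarrow> minor (r + p) ?L) at_top"
    by (intro tendsto_minor lim)
  moreover have "minor (r + p) ?L = minor r ?G * minor p ?H" by (rule minor_block)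
  moreover have "minor p ?H \<noteq> 0"
    using new[of "d + 2"] q(2)
    by (subst minor_scale[of p "\<lambda>_. walk S M q u x" "\<lambda>_. 1"]) (simp add: prod_zero_iff)
  ultimately have "\<forall>\<^sub>F s in at_top. minor (r + p) (\<lambda>i l. a s i * b s l * ?F s i l) \<noteq> 0"
    using old by (intro tendsto_imp_eventually_ne[where c = "minor (r + p) ?L"]) auto
  then have "\<forall>\<^sub>F s in at_top. minor (r + p) (?F s) \<noteq> 0"
    by eventually_elim (auto simp: minor_scale)
  then show ?thesis unfolding \<kappa>'_def \<mu>'_def c'_def by (intro exI[of _ d])
qed

lemma eventually_reached_casc:
  assumes "\<And>k. k < q \<Longrightarrow> walk S M k u x = 0" "walk S M q u x \<noteq> 0" "u \<notin> Y"
    and "i \<in> Y" "walk Y A k y i \<noteq> 0"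
  shows "\<forall>\<^sub>F s in at_top. walk S (casc s) (Suc q + k) u i \<noteq> 0"
proof -
  have "\<forall>\<^sub>F s in at_top. walk S (casc s) (Suc q + k) u i / s ^ k \<noteq> 0"
    by (rule tendsto_imp_eventually_ne[OF walk_casc_limit[OF assms(1,3,4)]]) (use assms in auto)
  then show ?thesis by eventually_elim auto
qed

end

text \<open>\<open>M\<close> is a weighting on the states in \<open>X\<close> and the inputs \<open>U\<close>, with Krylov vectors of \<open>M\<close> independent on \<open>r\<close>
  coordinates. Since a column \<open>walk k u\<close> is \<open>A\<^sup>k\<^sup>-\<^sup>1 B\<close> in terms of the blocks of \<open>M = [A, B]\<close>, the condition
  \<open>2 \<le> \<kappa> l\<close> puts the columns into the image of \<open>A\<close>.\<close>

definition grown :: "('a \<Rightarrow> 'a \<Rightarrow> bool) \<Rightarrow> 'a set \<Rightarrow> 'a set \<Rightarrow> 'a set \<Rightarrow> nat \<Rightarrow>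
    ('a \<Rightarrow> 'a \<Rightarrow> real) \<Rightarrow> (nat \<Rightarrow> nat) \<Rightarrow> (nat \<Rightarrow> 'a) \<Rightarrow> (nat \<Rightarrow> 'a) \<Rightarrow> bool" where
  "grown E V U X r M \<kappa> \<mu> c \<longleftrightarrow> X \<subseteq> V \<and>
     (\<forall>i\<in>V. \<forall>j\<in>V. M i j = M j i) \<and>
     (\<forall>i j. M i j \<noteq> 0 \<longrightarrow> i \<in> X \<and> j \<in> X \<union> U \<and> E i j) \<and>
     (\<forall>x\<in>X \<union> U. \<exists>u\<in>U. \<exists>k. walk (V \<union> U) M k u x \<noteq> 0) \<and>
     (\<forall>l<r. 2 \<le> \<kappa> l \<and> \<mu> l \<in> U \<and> c l \<in> X) \<and>
     minor r (\<lambda>i l. walk (V \<union> U) M (\<kappa> l) (\<mu> l) (c i)) \<noteq> 0"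

lemma grown_step:
  assumes g: "grown E V U X r M \<kappa> \<mu> c"
    and fin: "finite V" "finite U" "V \<inter> U = {}"
    and E: "\<And>i j. i \<in> V \<Longrightarrow> j \<in> V \<Longrightarrow> E i j \<Longrightarrow> E j i"
    and Y: "Y \<subseteq> V" "Y \<inter> X = {}" "y \<in> Y" and x: "x \<in> X \<union> U" "E y x"
    and A: "\<And>i j. A i j = A j i" "\<And>i j. A i j \<noteq> 0 \<Longrightarrow> i \<in> Y \<and> j \<in> Y \<and> E i j"
    and z: "\<And>i. i < p \<Longrightarrow> z i \<in> Y" "\<And>K. minor p (\<lambda>i l. walk Y A (K + l) y (z i)) \<noteq> 0"
    and rY: "\<And>i. i \<in> Y \<Longrightarrow> \<exists>k. walk Y A k y i \<noteq> 0"
  shows "\<exists>M' \<kappa>' \<mu>' c'. grown E V U (X \<union> Y) (r + p) M' \<kappa>' \<mu>' c'"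
proof -
  let ?S = "V \<union> U"
  have X: "X \<subseteq> V" and Msym: "\<And>i j. i \<in> V \<Longrightarrow> j \<in> V \<Longrightarrow> M i j = M j i"
    and Ms: "\<And>i j. M i j \<noteq> 0 \<Longrightarrow> i \<in> X \<and> j \<in> X \<union> U \<and> E i j"
    and reach: "\<And>x. x \<in> X \<union> U \<Longrightarrow> \<exists>u\<in>U. \<exists>k. walk ?S M k u x \<noteq> 0"
    and idx: "\<And>l. l < r \<Longrightarrow> 2 \<le> \<kappa> l \<and> \<mu> l \<in> U \<and> c l \<in> X"
    and full: "minor r (\<lambda>i l. walk ?S M (\<kappa> l) (\<mu> l) (c i)) \<noteq> 0"
    using g unfolding grown_def by auto
  have XUY: "i \<notin> Y" if "i \<in> X \<union> U" for i using that Y fin by blast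
  interpret cascade ?S Y M A x y
    by unfold_locales (use fin Y x X Ms A XUY in blast)+
  obtain u where u: "u \<in> U" "\<exists>k. walk ?S M k u x \<noteq> 0" using reach x by blast
  define q where "q = (LEAST k. walk ?S M k u x \<noteq> 0)"
  have q: "walk ?S M q u x \<noteq> 0" "\<And>k. k < q \<Longrightarrow> walk ?S M k u x = 0"
    unfolding q_def using LeastI_ex[OF u(2)] not_less_Least by blast+
  have uY: "u \<notin> Y" using u XUY by blast
  obtain d where ev1: "\<forall>\<^sub>F s in at_top. minor (r + p) (\<lambda>i l. walk ?S (casc s)
      (if l < r then \<kappa> l else Suc q + (d + 2 + (l - r))) (if l < r then \<mu> l else u)
      (if i < r then c i else z (i - r))) \<noteq> 0"
    using eventually_minor_casc[OF full _ _ z(2,1) q(2,1) uY] idx XUY by blast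
  define \<kappa>' where "\<kappa>' l = (if l < r then \<kappa> l else Suc q + (d + 2 + (l - r)))" for l
  define \<mu>' where "\<mu>' l = (if l < r then \<mu> l else u)" for l
  define c' where "c' i = (if i < r then c i else z (i - r))" for i
  have idx': "2 \<le> \<kappa>' l \<and> \<mu>' l \<in> U \<and> c' l \<in> X \<union> Y" if "l < r + p" for l
    using that idx[of l] z(1)[of "l - r"] u by (auto simp: \<kappa>'_def \<mu>'_def c'_def)
  have "\<forall>\<^sub>F s in at_top. \<forall>i\<in>Y. \<exists>k. walk ?S (casc s) k u i \<noteq> 0"
  proof (rule eventually_ball_finite)
    show "finite Y" using Y fin finite_subset by blast
    show "\<forall>i\<in>Y. \<forall>\<^sub>F s in at_top. \<exists>k. walk ?S (casc s) k u i \<noteq> 0"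
    proof
      fix i assume i: "i \<in> Y"
      then obtain k where "walk Y A k y i \<noteq> 0" using rY by blast
      then have "\<forall>\<^sub>F s in at_top. walk ?S (casc s) (Suc q + k) u i \<noteq> 0"
        using eventually_reached_casc[of q u i k] q uY i by blast
      then show "\<forall>\<^sub>F s in at_top. \<exists>k. walk ?S (casc s) k u i \<noteq> 0"
        by eventually_elim blast
    qed
  qed
  with ev1 have "\<forall>\<^sub>F s in at_top. minor (r + p) (\<lambda>i l. walk ?S (casc s) (\<kappa>' l) (\<mu>' l) (c' i)) \<noteq> 0
      \<and> (\<forall>i\<in>Y. \<exists>k. walk ?S (casc s) k u i \<noteq> 0)"
    unfolding \<kappa>'_def \<mu>'_def c'_def by eventually_elim blast
  then obtain s where s: "minor (r + p) (\<lambda>i l. walk ?S (casc s) (\<kappa>' l) (\<mu>' l) (c' i)) \<noteq> 0"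
      "\<And>i. i \<in> Y \<Longrightarrow> \<exists>k. walk ?S (casc s) k u i \<noteq> 0"
    using eventually_happens'[OF trivial_limit_at_top_linorder] by blast
  have reach': "\<exists>v\<in>U. \<exists>k. walk ?S (casc s) k v i \<noteq> 0" if "i \<in> X \<union> Y \<union> U" for i
  proof (cases "i \<in> Y")
    case True
    then show ?thesis using s(2) u by blast
  next
    case False
    then show ?thesis using reach[of i] that walk_casc_old[OF False] by auto
  qed
  show ?thesis
  proof (cases "x \<in> U")
    case True
    have "grown E V U (X \<union> Y) (r + p) (casc s) \<kappa>' \<mu>' c'"
      unfolding grown_def
    proof (intro conjI ballI allI impI)
      show "casc s i j = casc s j i" if "i \<in> V" "j \<in> V" for i j
        using Msym[OF that] A(1)[of i j] that True fin(3) by (auto simp: casc_def)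
      have "M i j \<noteq> 0 \<or> i = y \<and> j = x \<or> A i j \<noteq> 0" if "casc s i j \<noteq> 0" for i j
        using that by (auto simp: casc_def)
      then show "i \<in> X \<union> Y" "j \<in> X \<union> Y \<union> U" "E i j" if "casc s i j \<noteq> 0" for i j
        using Ms A(2) Y x that by blast+
    qed (use X Y reach' idx' s(1) in auto)
    then show ?thesis by blast
  next
    case False
    then have xX: "x \<in> X" using x by blast
    define N where "N t i j = casc s i j + t ^ 2 * of_bool (i = x \<and> j = y)" for t :: real and i j
    define B where "B t i j = M i j + s * A i j + t * (of_bool (i = y \<and> j = x) + of_bool (i = x \<and> j = y))"
      for t :: real and i j
    define D where "D t i = (if i \<in> Y then t else 1)" for t :: real and i
    have lim: "((\<lambda>t. walk ?S (N t) k v i) \<longlongrightarrow> walk ?S (casc s) k v i) (at_right 0)" for k v i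
    proof (rule tendsto_walk)
      fix i j
      have "((\<lambda>t. N t i j) \<longlongrightarrow> casc s i j + 0 ^ 2 * of_bool (i = x \<and> j = y)) (at_right 0)"
        unfolding N_def by (intro tendsto_intros)
      then show "((\<lambda>t. N t i j) \<longlongrightarrow> casc s i j) (at_right 0)" by simp
    qed
    have "((\<lambda>t. minor (r + p) (\<lambda>i l. walk ?S (N t) (\<kappa>' l) (\<mu>' l) (c' i))) \<longlongrightarrow>
        minor (r + p) (\<lambda>i l. walk ?S (casc s) (\<kappa>' l) (\<mu>' l) (c' i))) (at_right 0)"
      by (intro tendsto_minor lim)
    then have e1: "\<forall>\<^sub>F t in at_right 0. minor (r + p) (\<lambda>i l. walk ?S (N t) (\<kappa>' l) (\<mu>' l) (c' i)) \<noteq> 0"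
      by (rule tendsto_imp_eventually_ne) (rule s(1))
    have e2: "\<forall>\<^sub>F t in at_right 0. \<forall>i\<in>X \<union> Y \<union> U. \<exists>v\<in>U. \<exists>k. walk ?S (N t) k v i \<noteq> 0"
    proof (rule eventually_ball_finite)
      show "finite (X \<union> Y \<union> U)" using X Y fin finite_subset by blast
      show "\<forall>i\<in>X \<union> Y \<union> U. \<forall>\<^sub>F t in at_right 0. \<exists>v\<in>U. \<exists>k. walk ?S (N t) k v i \<noteq> 0"
      proof
        fix i assume "i \<in> X \<union> Y \<union> U"
        then obtain v k where vk: "v \<in> U" "walk ?S (casc s) k v i \<noteq> 0" using reach' by blast
        have "\<forall>\<^sub>F t in at_right 0. walk ?S (N t) k v i \<noteq> 0"
          by (rule tendsto_imp_eventually_ne[OF lim vk(2)])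
        then show "\<forall>\<^sub>F t in at_right 0. \<exists>v\<in>U. \<exists>k. walk ?S (N t) k v i \<noteq> 0"
          by eventually_elim (use vk in blast)
      qed
    qed
    have "\<forall>\<^sub>F t in at_right (0::real). t > 0" by (rule eventually_at_right_less)
    with e1 e2 have "\<forall>\<^sub>F t in at_right 0. minor (r + p) (\<lambda>i l. walk ?S (N t) (\<kappa>' l) (\<mu>' l) (c' i)) \<noteq> 0
        \<and> (\<forall>i\<in>X \<union> Y \<union> U. \<exists>v\<in>U. \<exists>k. walk ?S (N t) k v i \<noteq> 0) \<and> t > 0"
      by eventually_elim blast
    then obtain t where t: "minor (r + p) (\<lambda>i l. walk ?S (N t) (\<kappa>' l) (\<mu>' l) (c' i)) \<noteq> 0"
        "\<And>i. i \<in> X \<union> Y \<union> U \<Longrightarrow> \<exists>v\<in>U. \<exists>k. walk ?S (N t) k v i \<noteq> 0" "t > 0"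
      using eventually_happens'[OF trivial_limit_at_right_real] by blast
    have conj: "B t i j * D t j = D t i * N t i j" for i j
    proof -
      have "M i j * D t j = D t i * M i j"
        using Ms[of i j] XUY by (cases "M i j = 0") (auto simp: D_def)
      moreover have "A i j * D t j = D t i * A i j"
        using A(2)[of i j] by (cases "A i j = 0") (auto simp: D_def)
      moreover have "t * (of_bool (i = y \<and> j = x) + of_bool (i = x \<and> j = y)) * D t j =
          D t i * (of_bool (i = y \<and> j = x) + t ^ 2 * of_bool (i = x \<and> j = y))" (is "?l = ?r")
        using Y(3) XUY[OF x(1)] by (auto simp: D_def power2_eq_square)
      moreover have "B t i j * D t j = M i j * D t j + s * (A i j * D t j) + ?l"
        unfolding B_def by (simp add: algebra_simps)
      moreover have "D t i * N t i j = D t i * M i j + s * (D t i * A i j) + ?r"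
        unfolding N_def casc_def by (simp add: algebra_simps)
      ultimately show ?thesis by metis
    qed
    have Dx: "D t i \<noteq> 0" for i using t(3) by (simp add: D_def)
    have DU: "D t v = 1" if "v \<in> U" for v using that XUY by (simp add: D_def)
    have walkB: "walk ?S (B t) k v i = D t i * walk ?S (N t) k v i" if "v \<in> U" "i \<in> ?S" for k v i
      using walk_conj[of ?S "B t" "D t" "N t" i k v] conj that DU by simp
    have "minor (r + p) (\<lambda>i l. walk ?S (B t) (\<kappa>' l) (\<mu>' l) (c' i)) =
        minor (r + p) (\<lambda>i l. D t (c' i) * 1 * walk ?S (N t) (\<kappa>' l) (\<mu>' l) (c' i))"
      using idx' X Y by (intro minor_cong) (auto intro!: walkB)
    also have "\<dots> \<noteq> 0"
      using t(1) Dx by (subst minor_scale) (simp add: prod_zero_iff)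
    finally have full': "minor (r + p) (\<lambda>i l. walk ?S (B t) (\<kappa>' l) (\<mu>' l) (c' i)) \<noteq> 0" .
    have "E x y" using E[of y x] x xX X Y by blast
    then have supp: "i \<in> X \<union> Y \<and> j \<in> X \<union> Y \<union> U \<and> E i j" if "B t i j \<noteq> 0" for i j
    proof -
      have "M i j \<noteq> 0 \<or> i = y \<and> j = x \<or> i = x \<and> j = y \<or> A i j \<noteq> 0"
        using that by (auto simp: B_def)
      then show ?thesis using Ms[of i j] A(2)[of i j] Y(3) x xX \<open>E x y\<close> by (elim disjE) auto
    qed
    have "grown E V U (X \<union> Y) (r + p) (B t) \<kappa>' \<mu>' c'"
      unfolding grown_def
    proof (intro conjI ballI allI impI)
      show "B t i j = B t j i" if "i \<in> V" "j \<in> V" for i j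
      proof -
        have "t * (of_bool (i = y \<and> j = x) + of_bool (i = x \<and> j = y)) =
            t * (of_bool (j = y \<and> i = x) + of_bool (j = x \<and> i = y))"
          unfolding conj_commute[of "i = y"] conj_commute[of "i = x"]
          by (rule arg_cong[of _ _ "(*) t", OF add.commute])
        then show ?thesis unfolding B_def using Msym[OF that] A(1)[of i j] by presburger
      qed
      show "i \<in> X \<union> Y" "j \<in> X \<union> Y \<union> U" "E i j" if "B t i j \<noteq> 0" for i j
        using supp[OF that] by auto
      show "\<exists>v\<in>U. \<exists>k. walk ?S (B t) k v i \<noteq> 0" if "i \<in> X \<union> Y \<union> U" for i
      proof -
        from t(2)[OF that] obtain v k where "v \<in> U" "walk ?S (N t) k v i \<noteq> 0" by blast
        moreover have "i \<in> ?S" using that X Y by blast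
        ultimately show ?thesis using walkB[of v i k] Dx by (intro bexI[of _ v] exI[of _ k]) auto
      qed
    qed (use X Y idx' full' in auto)
    then show ?thesis by blast
  qed
qed

lemma grown_exists:
  assumes fin: "finite V" "finite U" "V \<inter> U = {}"
    and E: "\<And>i j. i \<in> V \<Longrightarrow> j \<in> V \<Longrightarrow> E i j \<Longrightarrow> E j i"
    and conn: "\<And>X. X \<subset> V \<Longrightarrow> \<exists>y\<in>V - X. \<exists>x\<in>X \<union> U. E y x"
    and \<C>: "\<And>Y. Y \<in> \<C> \<Longrightarrow> Y \<subseteq> V \<and> cycle_set E Y" "pairwise disjnt \<C>"
  shows "\<exists>M \<kappa> \<mu> c. grown E V U V (card (\<Union>\<C>)) M \<kappa> \<mu> c"
proof -
  have step: "\<exists>M \<kappa> \<mu> c. grown E V U V (card (\<Union>\<C>)) M \<kappa> \<mu> c"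
    if "grown E V U X (card (X \<inter> \<Union>\<C>)) M \<kappa> \<mu> c" "\<And>Y. Y \<in> \<C> \<Longrightarrow> Y \<subseteq> X \<or> Y \<inter> X = {}" for X M \<kappa> \<mu> c
    using that
  proof (induction "card (V - X)" arbitrary: X M \<kappa> \<mu> c rule: less_induct)
    case less
    have XV: "X \<subseteq> V" using less.prems(1) unfolding grown_def by blast
    show ?case
    proof (cases "X = V")
      case True
      moreover have "V \<inter> \<Union>\<C> = \<Union>\<C>" using \<C>(1) by blast
      ultimately show ?thesis using less.prems(1) by auto
    next
      case False
      then obtain y x where yx: "y \<in> V" "y \<notin> X" "x \<in> X \<union> U" "E y x" using conn[of X] XV by blast
      have smaller: "card (V - (X \<union> Y)) < card (V - X)" if "y \<in> Y" for Y
        using that yx fin(1) by (intro psubset_card_mono) auto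
      show ?thesis
      proof (cases "y \<in> \<Union>\<C>")
        case True
        then obtain Y where Y: "Y \<in> \<C>" "y \<in> Y" by blast
        then have YX: "Y \<inter> X = {}" using less.prems(2) yx(2) by blast
        have finY: "finite Y" using \<C>(1) Y fin(1) finite_subset by blast
        obtain A z where A: "\<And>i j. A i j = A j i" "\<And>i j. A i j \<noteq> 0 \<Longrightarrow> i \<in> Y \<and> j \<in> Y \<and> E i j"
          "bij_betw z {..<card Y} Y" "\<And>K. minor (card Y) (\<lambda>i l. walk Y A (K + l) y (z i)) \<noteq> 0"
        proof -
          have "cycle_set E Y" "\<forall>i\<in>Y. \<forall>j\<in>Y. E i j \<longrightarrow> E j i"
            using \<C>(1)[OF Y(1)] E by blast+
          then show ?thesis using cycle_set_weights[of E Y y] finY Y(2) that by blast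
        qed
        have reach: "\<exists>k. walk Y A k y i \<noteq> 0" if i: "i \<in> Y" for i
        proof -
          obtain i' where i': "i' < card Y" "z i' = i" using A(3) i by (metis bij_betw_iff_bijections lessThan_iff)
          obtain w where "walk Y A (0 + w i') y (z i') \<noteq> 0"
            using minor_matching[OF A(4)[of 0]] i'(1) by metis
          then show ?thesis using i'(2) by auto
        qed
        have "\<exists>M' \<kappa>' \<mu>' c'. grown E V U (X \<union> Y) (card (X \<inter> \<Union>\<C>) + card Y) M' \<kappa>' \<mu>' c'"
          by (rule grown_step[OF less.prems(1) fin E _ YX Y(2) yx(3,4) A(1,2) _ A(4) reach])
            (use \<C>(1) Y A(3) in \<open>auto simp: bij_betw_def\<close>)
        moreover have "card (X \<inter> \<Union>\<C>) + card Y = card ((X \<union> Y) \<inter> \<Union>\<C>)"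
        proof -
          have "(X \<union> Y) \<inter> \<Union>\<C> = (X \<inter> \<Union>\<C>) \<union> Y" using Y by blast
          moreover have "finite (X \<inter> \<Union>\<C>)" using XV fin(1) finite_subset by blast
          moreover have "(X \<inter> \<Union>\<C>) \<inter> Y = {}" using YX by blast
          ultimately show ?thesis using finY by (simp add: card_Un_disjoint)
        qed
        ultimately obtain M' \<kappa>' \<mu>' c' where g: "grown E V U (X \<union> Y) (card ((X \<union> Y) \<inter> \<Union>\<C>)) M' \<kappa>' \<mu>' c'"
          by auto
        show ?thesis
        proof (rule less.hyps[OF smaller[OF Y(2)] g])
          fix Y' assume "Y' \<in> \<C>"
          then show "Y' \<subseteq> X \<union> Y \<or> Y' \<inter> (X \<union> Y) = {}"
            using less.prems(2)[of Y'] \<C>(2) Y(1) unfolding pairwise_def disjnt_def by blast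
        qed
      next
        case False
        have "\<exists>M' \<kappa>' \<mu>' c'. grown E V U (X \<union> {y}) (card (X \<inter> \<Union>\<C>) + 0) M' \<kappa>' \<mu>' c'"
          by (rule grown_step[OF less.prems(1) fin E _ _ _ yx(3,4), where A = "\<lambda>_ _. 0" and z = "\<lambda>_. y"])
            (use yx in \<open>auto simp: minor_def intro: exI[of _ 0]\<close>)
        moreover have "(X \<union> {y}) \<inter> \<Union>\<C> = X \<inter> \<Union>\<C>" using False by blast
        ultimately obtain M' \<kappa>' \<mu>' c' where g: "grown E V U (X \<union> {y}) (card ((X \<union> {y}) \<inter> \<Union>\<C>)) M' \<kappa>' \<mu>' c'"
          by auto
        show ?thesis
          by (rule less.hyps[OF smaller g]) (use less.prems(2) False in auto)
      qed
    qed
  qed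
  have "\<exists>u\<in>U. \<exists>k. walk (V \<union> U) (\<lambda>_ _. 0) k u x \<noteq> 0" if "x \<in> U" for x
    using that by (intro bexI[of _ x] exI[of _ 0]) simp
  then have "grown E V U {} (card ({} \<inter> \<Union>\<C>)) (\<lambda>_ _. 0) (\<lambda>_. 0) undefined undefined"
    unfolding grown_def by (auto simp: minor_def)
  then show ?thesis using step by blast
qed

section \<open>Matchings and cycles\<close>

lemma cycle_set_pair:
  assumes "a \<noteq> b" "E a b" "E b a"
  shows "cycle_set E {a, b}"
proof -
  have *: "\<exists>z. bij_betw z {..<card {a, b}} {a, b} \<and> z 0 = x \<and>
      (\<forall>i<card {a, b}. E (z i) (z (Suc i mod card {a, b})))"
    if "{x, y} = {a, b}" "x \<noteq> y" "E x y" "E y x" for x y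
  proof (intro exI[of _ "\<lambda>i::nat. if i = 0 then x else y"] conjI allI impI)
    show "bij_betw (\<lambda>i::nat. if i = 0 then x else y) {..<card {a, b}} {a, b}"
      using that unfolding that(1)[symmetric]
      by (auto simp: bij_betw_def inj_on_def less_2_cases_iff lessThan_Suc numeral_2_eq_2)
  next
    fix i assume "i < card {a, b}"
    then have "i = 0 \<or> i = 1" using assms(1) by auto
    then show "E (if i = 0 then x else y) (if Suc i mod card {a, b} = 0 then x else y)"
      using that assms(1) by auto
  qed simp
  show ?thesis unfolding cycle_set_def using *[of a b] *[of b a] assms by auto
qed

lemma orbit_cycle_set:
  assumes g: "g permutes R" and fin: "finite R" and y: "y \<in> R" and E: "\<And>i. i \<in> R \<Longrightarrow> E i (g i)"
  obtains Orb where "y \<in> Orb" "Orb \<subseteq> R" "cycle_set E Orb" "g ` Orb = Orb"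
proof -
  have perm: "permutation g" using g fin permutation_permutes by blast
  define L where "L = least_power g y"
  have L: "(g ^^ L) y = y" "0 < L"
    unfolding L_def using least_power_of_permutation[OF perm] by auto
  have inj: "inj_on (\<lambda>i. (g ^^ i) y) {..<L}"
    using cycle_of_permutation[OF perm, of y] unfolding L_def
    by (simp add: distinct_map atLeast0LessThan)
  define Orb where "Orb = (\<lambda>i. (g ^^ i) y) ` {..<L}"
  have card: "card Orb = L" unfolding Orb_def using inj by (simp add: card_image)
  have inOrb: "(g ^^ k) y \<in> Orb" for k
  proof -
    have "(g ^^ (k mod L)) y \<in> Orb" unfolding Orb_def using L(2) by (intro imageI) simp
    then show ?thesis by (simp add: funpow_mod_eq[OF L(1)])
  qed
  have OR: "Orb \<subseteq> R"
  proof -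
    have "(g ^^ k) y \<in> R" for k
      using y by (induction k) (auto simp: permutes_in_image[OF g])
    then show ?thesis unfolding Orb_def by blast
  qed
  have "cycle_set E Orb"
    unfolding cycle_set_def card
  proof
    fix y' assume "y' \<in> Orb"
    then obtain j where j: "y' = (g ^^ j) y" unfolding Orb_def by blast
    have z1: "(g ^^ i) y' = (g ^^ (i + j)) y" for i by (simp add: j funpow_add)
    have z2: "(g ^^ i) y' = (g ^^ j) ((g ^^ i) y)" for i
      unfolding z1 by (simp add: add.commute[of i j] funpow_add)
    have "inj (g ^^ j)" using permutes_inj[OF g] by (rule inj_fn)
    then have inj': "inj_on (\<lambda>i. (g ^^ i) y') {..<L}"
      using inj unfolding inj_on_def z2 by (auto dest: injD)
    moreover have "(\<lambda>i. (g ^^ i) y') ` {..<L} = Orb"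
    proof (rule card_subset_eq)
      show "finite Orb" using OR fin finite_subset by blast
      show "(\<lambda>i. (g ^^ i) y') ` {..<L} \<subseteq> Orb" using inOrb z1 by auto
      show "card ((\<lambda>i. (g ^^ i) y') ` {..<L}) = card Orb" using inj' card by (simp add: card_image)
    qed
    ultimately have "bij_betw (\<lambda>i. (g ^^ i) y') {..<L} Orb" by (simp add: bij_betw_def)
    moreover have "E ((g ^^ i) y') ((g ^^ (Suc i mod L)) y')" for i
    proof -
      have "(g ^^ L) y' = y'" using z2[of L] L(1) j by simp
      then have "(g ^^ (Suc i mod L)) y' = g ((g ^^ i) y')" by (simp add: funpow_mod_eq)
      then show ?thesis using E[of "(g ^^ i) y'"] inOrb OR z1 by auto
    qed
    ultimately show "\<exists>z. bij_betw z {..<L} Orb \<and> z 0 = y' \<and> (\<forall>i<L. E (z i) (z (Suc i mod L)))"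
      by (intro exI[of _ "\<lambda>i. (g ^^ i) y'"]) simp
  qed
  moreover have "g ` Orb = Orb"
  proof (rule card_subset_eq)
    show "finite Orb" using OR fin finite_subset by blast
    show "g ` Orb \<subseteq> Orb"
    proof
      fix a assume "a \<in> g ` Orb"
      then obtain i where "a = g ((g ^^ i) y)" unfolding Orb_def by blast
      then show "a \<in> Orb" using inOrb[of "Suc i"] by simp
    qed
    show "card (g ` Orb) = card Orb" by (intro card_image inj_on_subset[OF permutes_inj[OF g]]) simp
  qed
  ultimately show ?thesis using that inOrb[of 0] OR by simp
qed

lemma matching_cycle_sets:
  assumes "finite R" "inj_on f R" "R \<subseteq> V" "f ` R \<subseteq> V \<union> U" "V \<inter> U = {}"
    and "\<And>i. i \<in> R \<Longrightarrow> E i (f i)" and E: "\<And>i j. i \<in> V \<Longrightarrow> j \<in> V \<Longrightarrow> E i j \<Longrightarrow> E j i"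
  shows "\<exists>\<C> S. (\<forall>Y\<in>\<C>. Y \<subseteq> R \<union> f ` R \<inter> V \<and> cycle_set E Y) \<and> pairwise disjnt \<C> \<and>
    S \<subseteq> R \<and> f ` S \<subseteq> U \<and> S \<inter> \<Union>\<C> = {} \<and> card R \<le> card (\<Union>\<C>) + card S"
  using assms(1,2,3,4,6)
proof (induction "card R" arbitrary: R rule: less_induct)
  case less
  have hyp: "\<exists>\<C> S. (\<forall>Y\<in>\<C>. Y \<subseteq> R' \<union> f ` R' \<inter> V \<and> cycle_set E Y) \<and> pairwise disjnt \<C> \<and>
    S \<subseteq> R' \<and> f ` S \<subseteq> U \<and> S \<inter> \<Union>\<C> = {} \<and> card R' \<le> card (\<Union>\<C>) + card S" if "R' \<subset> R" for R'
  proof (rule less.hyps)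
    show "card R' < card R" using that less.prems(1) by (rule psubset_card_mono[rotated])
    show "finite R'" using that less.prems(1) finite_subset by blast
    show "inj_on f R'" using that less.prems(2) inj_on_subset by blast
  qed (use that less.prems in blast)+
  show ?case
  proof (cases "R \<subseteq> f ` R")
    case False
    then obtain e where e: "e \<in> R" "e \<notin> f ` R" by blast
    show ?thesis
    proof (cases "f e \<in> U")
      case True
      let ?R = "R - {e}"
      have smaller: "?R \<subset> R" using e by blast
      obtain \<C> S where IH: "\<forall>Y\<in>\<C>. Y \<subseteq> ?R \<union> f ` ?R \<inter> V \<and> cycle_set E Y"
        "pairwise disjnt \<C>" "S \<subseteq> ?R" "f ` S \<subseteq> U" "S \<inter> \<Union>\<C> = {}" "card ?R \<le> card (\<Union>\<C>) + card S"
        using hyp[OF smaller] by blast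
      have "finite S" "e \<notin> S" using IH(3) less.prems(1) by (auto intro: finite_subset)
      then have "card R \<le> card (\<Union>\<C>) + card (insert e S)"
        using IH(6) e less.prems(1) by simp
      moreover have "e \<notin> \<Union>\<C>" using IH(1) e(2) by blast
      moreover have "\<forall>Y\<in>\<C>. Y \<subseteq> R \<union> f ` R \<inter> V \<and> cycle_set E Y" using IH(1) by blast
      ultimately show ?thesis using IH e True
        by (intro exI[of _ \<C>] exI[of _ "insert e S"]) auto
    next
      case False
      let ?R = "R - {e, f e}"
      have e': "f e \<in> V" "f e \<noteq> e" "e \<in> V" using less.prems(3,4) False e by (auto simp: image_iff)
      have smaller: "?R \<subset> R" using e by blast
      obtain \<C> S where IH: "\<forall>Y\<in>\<C>. Y \<subseteq> ?R \<union> f ` ?R \<inter> V \<and> cycle_set E Y"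
        "pairwise disjnt \<C>" "S \<subseteq> ?R" "f ` S \<subseteq> U" "S \<inter> \<Union>\<C> = {}" "card ?R \<le> card (\<Union>\<C>) + card S"
        using hyp[OF smaller] by blast
      have "f e \<notin> f ` ?R" using less.prems(2) e(1) by (auto simp: inj_on_def)
      then have new: "{e, f e} \<inter> \<Union>\<C> = {}" using IH(1) e(2) by blast
      have "finite (R \<union> f ` R \<inter> V)" using less.prems(1) by auto
      moreover have "\<Union>\<C> \<subseteq> R \<union> f ` R \<inter> V" using IH(1) by blast
      ultimately have finC: "finite (\<Union>\<C>)" using finite_subset by blast
      have "card R \<le> card ?R + 2"
        using card_mono[of "?R \<union> {e, f e}" R] card_Un_le[of ?R "{e, f e}"] less.prems(1) e'(2) by auto
      moreover have "card (\<Union>(insert {e, f e} \<C>)) = 2 + card (\<Union>\<C>)"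
        using new finC e'(2) by (simp add: card_insert_if)
      ultimately have "card R \<le> card (\<Union>(insert {e, f e} \<C>)) + card S" using IH(6) by linarith
      moreover have "cycle_set E {e, f e}"
        using e' E less.prems(5)[OF e(1)] by (intro cycle_set_pair) auto
      moreover have "pairwise disjnt (insert {e, f e} \<C>)"
        using IH(2) new by (auto simp: pairwise_insert disjnt_def)
      moreover have "\<forall>Y\<in>insert {e, f e} \<C>. Y \<subseteq> R \<union> f ` R \<inter> V \<and> cycle_set E Y"
        using IH(1) \<open>cycle_set E {e, f e}\<close> e e' by blast
      ultimately show ?thesis using IH(3-5) new
        by (intro exI[of _ "insert {e, f e} \<C>"] exI[of _ S]) auto
    qed
  next
    case True
    have fR: "f ` R = R"
      using card_subset_eq[of "f ` R" R] True less.prems(1,2) by (simp add: card_image)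
    show ?thesis
    proof (cases "R = {}")
      case True
      then show ?thesis by (intro exI[of _ "{}"]) auto
    next
      case False
      then obtain y where y: "y \<in> R" by blast
      define g where "g i = (if i \<in> R then f i else i)" for i
      have g: "g permutes R"
        by (rule bij_imp_permutes) (use less.prems(2) fR in \<open>auto simp: g_def bij_betw_def inj_on_def\<close>)
      obtain Orb where Orb: "y \<in> Orb" "Orb \<subseteq> R" "cycle_set E Orb" "g ` Orb = Orb"
        using orbit_cycle_set[OF g less.prems(1) y, of E] less.prems(5) by (auto simp: g_def)
      let ?R = "R - Orb"
      have smaller: "?R \<subset> R" using Orb y by blast
      obtain \<C> S where IH: "\<forall>Y\<in>\<C>. Y \<subseteq> ?R \<union> f ` ?R \<inter> V \<and> cycle_set E Y"
        "pairwise disjnt \<C>" "S \<subseteq> ?R" "f ` S \<subseteq> U" "S \<inter> \<Union>\<C> = {}" "card ?R \<le> card (\<Union>\<C>) + card S"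
        using hyp[OF smaller] by blast
      have fO: "f ` Orb = Orb" using Orb(2,4) by (auto simp: g_def subset_iff image_iff)
      have "f ` ?R = R - Orb" using inj_on_image_set_diff[OF less.prems(2), of R Orb] Orb(2) fO fR by auto
      then have new: "Orb \<inter> \<Union>\<C> = {}" using IH(1) by blast
      have finO: "finite Orb" using Orb(2) less.prems(1) finite_subset by blast
      have "\<Union>\<C> \<subseteq> R" using IH(1) \<open>f ` ?R = R - Orb\<close> by blast
      then have finC: "finite (\<Union>\<C>)" using less.prems(1) finite_subset by blast
      have "card (\<Union>(insert Orb \<C>)) = card Orb + card (\<Union>\<C>)"
        using new finC finO by (simp add: card_Un_disjoint)
      moreover have "card R = card ?R + card Orb"
        using Orb(2) less.prems(1) finO by (simp add: card_Diff_subset card_mono)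
      ultimately have "card R \<le> card (\<Union>(insert Orb \<C>)) + card S" using IH(6) by linarith
      moreover have "pairwise disjnt (insert Orb \<C>)"
        using IH(2) new by (auto simp: pairwise_insert disjnt_def)
      moreover have "\<forall>Y\<in>insert Orb \<C>. Y \<subseteq> R \<union> f ` R \<inter> V \<and> cycle_set E Y"
        using IH(1) Orb by blast
      ultimately show ?thesis using IH(3-5) new Orb
        by (intro exI[of _ "insert Orb \<C>"] exI[of _ S]) auto
    qed
  qed
qed

section \<open>Rank\<close>

context vec_space
begin

lemma card_lin_indpt_le_dim_span:
  assumes "W \<subseteq> carrier_vec n" "finite W" "U \<subseteq> span W" "lin_indpt U"
  shows "finite U" "card U \<le> vectorspace.dim class_ring (span_vs W)"
proof -
  have vs: "vectorspace class_ring (span_vs W)"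
    using assms(1) span_is_subspace subspace_is_vs by simp
  have fd: "vectorspace.fin_dim class_ring (span_vs W)" using fin_dim_span assms by simp
  have li: "LinearCombinations.module.lin_indpt class_ring (span_vs W) U"
    using span_li_not_depend(2)[OF assms(3)] span_is_submodule assms(1,4) by simp
  show "finite U" "card U \<le> vectorspace.dim class_ring (span_vs W)"
    using vectorspace.li_le_dim[OF vs fd _ li] assms(3) by auto
qed

lemma rank_basis:
  assumes "M \<in> carrier_mat n c"
  obtains S where "S \<subseteq> set (cols M)" "lin_indpt S" "card S = rank M"
proof -
  obtain S where S: "maximal S (\<lambda>T. T \<subseteq> set (cols M) \<and> lin_indpt T)"
    using maximal_exists[of "\<lambda>T. T \<subseteq> set (cols M) \<and> lin_indpt T" "card (set (cols M))" "{}"]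
    by (meson List.finite_set card_mono empty_iff empty_subsetI finite_lin_indpt2 rev_finite_subset)
  show ?thesis
    using that[of S] rank_card_indpt[OF assms S] S unfolding maximal_def by simp
qed

lemma rank_mono:
  assumes M: "M \<in> carrier_mat n c" and N: "N \<in> carrier_mat n d"
    and sub: "set (cols M) \<subseteq> span (set (cols N))"
  shows "rank M \<le> rank N"
proof -
  obtain S where "S \<subseteq> set (cols M)" "lin_indpt S" "card S = rank M" using rank_basis[OF M] .
  moreover have "set (cols N) \<subseteq> carrier_vec n" using cols_dim N by blast
  ultimately show ?thesis
    using card_lin_indpt_le_dim_span(2)[of "set (cols N)" S] sub unfolding rank_def by auto
qed

lemma rank_matching:
  assumes M: "M \<in> carrier_mat n c"
  obtains \<rho> \<gamma> where "inj_on \<rho> {..<rank M}" "inj_on \<gamma> {..<rank M}"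
    "\<And>l. l < rank M \<Longrightarrow> \<rho> l < n \<and> \<gamma> l < c \<and> M $$ (\<rho> l, \<gamma> l) \<noteq> 0"
proof -
  obtain S where S: "S \<subseteq> set (cols M)" "lin_indpt S" "card S = rank M" using rank_basis[OF M] .
  have finS: "finite S" using S(1) finite_subset by blast
  have Mc: "set (cols M) \<subseteq> carrier_vec n" using cols_dim M by blast
  have units: "set (unit_vecs n) \<subseteq> carrier_vec n" by (rule unit_vecs_carrier)
  have sub: "S \<subseteq> span (set (unit_vecs n))" using S(1) Mc span_unit_vecs_is_carrier by simp
  obtain C where C: "finite C" "C \<subseteq> carrier V" "C \<inter> S = {}"
    "int (card C) \<le> int (card (set (unit_vecs n :: 'a vec list))) - int (card S)"
    "span (S \<union> C) = span (set (unit_vecs n))"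
    using replacement[OF finS List.finite_set _ S(2) sub] units by (metis module_vec_simps(3))
  then have C2: "C \<subseteq> carrier_vec n" by simp
  have card_units: "card (set (unit_vecs n :: 'a vec list)) = n"
    using distinct_card[OF unit_vecs_distinct] by simp
  have gen: "span (S \<union> C) = carrier_vec n" using C(5) span_unit_vecs_is_carrier by simp
  have "n \<le> card (S \<union> C)"
    using gen_ge_dim[of "S \<union> C"] finS C(1) C2 S(1) Mc gen dim_is_n by auto
  then have card: "card (S \<union> C) = n"
    using C(4) card_Un_le[of S C] unfolding card_units by linarith
  obtain ss where ss: "set ss = S" "distinct ss" using finite_distinct_list[OF finS] by blast
  obtain cs where cs: "set cs = C" "distinct cs" using finite_distinct_list[OF C(1)] by blast
  define vs where "vs = ss @ cs"
  have vs: "set vs = S \<union> C" "distinct vs" unfolding vs_def using ss cs C(3) by auto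
  then have len: "length vs = n" using card distinct_card by metis
  have lss: "length ss = rank M" using ss S(3) distinct_card by metis
  have le: "rank M \<le> n" using len lss unfolding vs_def by simp
  have vsc: "set vs \<subseteq> carrier_vec n" using vs(1) S(1) Mc C2 by blast
  define N where "N = mat_of_cols n vs"
  have N: "N \<in> carrier_mat n n" unfolding N_def using len mat_of_cols_carrier(1) by metis
  have "cols N = vs" unfolding N_def using vsc by simp
  moreover have "basis (S \<union> C)"
    by (rule dim_gen_is_basis) (use finS C(1) C2 S(1) Mc gen card dim_is_n in auto)
  ultimately have "rank N = n"
    using lin_indpt_full_rank[OF N] vs unfolding basis_def by simp
  then have "det N \<noteq> 0" using det_rank_iff[OF N] by simp
  then have "\<exists>p. p permutes {0..<n} \<and> (\<forall>j<n. N $$ (p j, j) \<noteq> 0)"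
  proof -
    have "\<exists>p\<in>{p. p permutes {0..<n}}. signof p * (\<Prod>j<n. N $$ (p j, j)) \<noteq> 0"
      using sum.neutral[of "{p. p permutes {0..<n}}" "\<lambda>p. signof p * (\<Prod>j<n. N $$ (p j, j))"]
        \<open>det N \<noteq> 0\<close> unfolding det_col[OF N] by blast
    then obtain p where p: "p permutes {0..<n}" "(\<Prod>j<n. N $$ (p j, j)) \<noteq> 0" by auto
    have "N $$ (p j, j) \<noteq> 0" if "j < n" for j
      using p(2) that prod_zero[of "{..<n}" "\<lambda>j. N $$ (p j, j)"] by blast
    then show ?thesis using p(1) by blast
  qed
  then obtain p where p: "p permutes {0..<n}" "\<And>j. j < n \<Longrightarrow> N $$ (p j, j) \<noteq> 0" by blast
  have "\<exists>g. g < c \<and> ss ! l = col M g" if "l < rank M" for l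
  proof -
    have "ss ! l \<in> set ss" using that lss by (intro nth_mem) simp
    then have "ss ! l \<in> set (cols M)" using ss(1) S(1) by blast
    then obtain g where "g < length (cols M)" "cols M ! g = ss ! l" by (auto simp: in_set_conv_nth)
    then show ?thesis using M by (auto simp: cols_nth)
  qed
  then obtain \<gamma> where \<gamma>: "\<And>l. l < rank M \<Longrightarrow> \<gamma> l < c \<and> ss ! l = col M (\<gamma> l)" by metis
  show ?thesis
  proof (rule that[of p \<gamma>])
    show "inj_on p {..<rank M}" using permutes_inj[OF p(1)] inj_on_subset by blast
    show "inj_on \<gamma> {..<rank M}"
    proof (rule inj_onI)
      fix i j assume ij: "i \<in> {..<rank M}" "j \<in> {..<rank M}" "\<gamma> i = \<gamma> j"
      then have "ss ! i = ss ! j" using \<gamma>[of i] \<gamma>[of j] by simp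
      then show "i = j" using nth_eq_iff_index_eq[OF ss(2)] ij(1,2) lss by simp
    qed
    fix l assume l: "l < rank M"
    then have ln: "l < n" "p l < n" using le permutes_in_image[OF p(1), of l] by auto
    have "N $$ (p l, l) = vs ! l $ p l" unfolding N_def using ln len by (simp add: mat_of_cols_index)
    also have "vs ! l = col M (\<gamma> l)" unfolding vs_def using l lss \<gamma> by (simp add: nth_append)
    also have "col M (\<gamma> l) $ p l = M $$ (p l, \<gamma> l)" using M ln \<gamma>[OF l] by simp
    finally show "p l < n \<and> \<gamma> l < c \<and> M $$ (p l, \<gamma> l) \<noteq> 0" using p(2)[OF ln(1)] ln \<gamma>[OF l] by simp
  qed
qed

end

lemma minor_lin_indpt:
  assumes g: "\<And>j. j < r \<Longrightarrow> g j \<in> carrier_vec n" and \<rho>: "\<And>i. i < r \<Longrightarrow> \<rho> i < n"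
    and nz: "minor r (\<lambda>i j. g j $ \<rho> i) \<noteq> 0"
  shows "LinearCombinations.module.lin_indpt class_ring (module_vec TYPE(real) n) (g ` {..<r})"
    "card (g ` {..<r}) = r"
proof -
  interpret vec_space "TYPE(real)" n .
  have inj: "inj_on g {..<r}"
    using minor_inj_rows[of r "\<lambda>v j. v $ \<rho> j" g] nz minor_transpose[of r "\<lambda>i j. g j $ \<rho> i"] by simp
  then show "card (g ` {..<r}) = r" by (simp add: card_image)
  define G where "G = mat_of_cols n (map g [0..<r])"
  have G: "G \<in> carrier_mat n r"
    unfolding G_def using mat_of_cols_carrier(1)[of n "map g [0..<r]"] by simp
  have colsG: "cols G = map g [0..<r]" unfolding G_def using g by (intro cols_mat_of_cols) auto
  have set: "set (cols G) = g ` {..<r}" unfolding colsG by (auto simp: atLeast0LessThan)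
  have dist: "distinct (cols G)" unfolding colsG using inj by (simp add: distinct_map atLeast0LessThan)
  show "lin_indpt (g ` {..<r})"
  proof
    assume "lin_dep (g ` {..<r})"
    then obtain v where v: "v \<in> carrier_vec r" "v \<noteq> 0\<^sub>v r" "G *\<^sub>v v = 0\<^sub>v n"
      using lin_depE[OF G _ dist] set by metis
    have "\<exists>i<r. v $ i \<noteq> 0" using v(1,2) by (metis eq_vecI carrier_vecD index_zero_vec(1,2))
    moreover have "(\<Sum>j<r. g j $ \<rho> i * v $ j) = 0" if "i < r" for i
    proof -
      have "(G *\<^sub>v v) $ \<rho> i = (\<Sum>j<r. g j $ \<rho> i * v $ j)"
        using \<rho>[OF that] v(1) by (simp add: G_def scalar_prod_def atLeast0LessThan mat_of_cols_index)
      then show ?thesis using v(3) \<rho>[OF that] by simp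
    qed
    ultimately have "minor r (\<lambda>i j. g j $ \<rho> i) = 0"
      unfolding minor_eq_0_iff by (intro exI[of _ "\<lambda>i. v $ i"]) blast
    then show False using nz by simp
  qed
qed

lemma rank_ge_minor:
  assumes M: "M \<in> carrier_mat n c"
    and g: "\<And>j. j < r \<Longrightarrow> g j \<in> LinearCombinations.module.span class_ring (module_vec TYPE(real) n) (set (cols M))"
    and \<rho>: "\<And>i. i < r \<Longrightarrow> \<rho> i < n" and nz: "minor r (\<lambda>i j. g j $ \<rho> i) \<noteq> 0"
  shows "r \<le> vec_space.rank n M"
proof -
  interpret vec_space "TYPE(real)" n .
  have Mc: "set (cols M) \<subseteq> carrier_vec n" using cols_dim M by blast
  then have "g j \<in> carrier_vec n" if "j < r" for j using g[OF that] span_closed by auto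
  then show ?thesis
    using minor_lin_indpt[OF _ \<rho> nz] card_lin_indpt_le_dim_span(2)[OF Mc, of "g ` {..<r}"] g
    unfolding rank_def by auto
qed

lemma minor_spans_cols:
  assumes M: "M \<in> carrier_mat n c" and r: "vec_space.rank n M \<le> r"
    and g: "\<And>j. j < r \<Longrightarrow> g j \<in> LinearCombinations.module.span class_ring (module_vec TYPE(real) n) (set (cols M))"
    and \<rho>: "\<And>i. i < r \<Longrightarrow> \<rho> i < n" and nz: "minor r (\<lambda>i j. g j $ \<rho> i) \<noteq> 0"
  shows "set (cols M) \<subseteq> LinearCombinations.module.span class_ring (module_vec TYPE(real) n) (g ` {..<r})"
proof -
  interpret vec_space "TYPE(real)" n .
  have Mc: "set (cols M) \<subseteq> carrier_vec n" using cols_dim M by blast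
  have gc: "g j \<in> carrier_vec n" if "j < r" for j using g[OF that] Mc span_closed by auto
  note li = minor_lin_indpt[OF gc \<rho> nz, simplified]
  show ?thesis
  proof
    fix v assume v: "v \<in> set (cols M)"
    show "v \<in> span (g ` {..<r})"
    proof (rule ccontr)
      assume nv: "v \<notin> span (g ` {..<r})"
      have gsub: "g ` {..<r} \<subseteq> carrier_vec n" using gc by auto
      have "g ` {..<r} \<subseteq> span (g ` {..<r})" by (rule in_own_span) (use gsub in simp)
      then have vg: "v \<notin> g ` {..<r}" using nv by blast
      have "lin_indpt (g ` {..<r} \<union> {v})"
        using lin_dep_iff_in_span[OF gsub li(1) _ vg] v Mc nv by auto
      moreover have "g ` {..<r} \<union> {v} \<subseteq> span (set (cols M))"
        using g v in_own_span[of "set (cols M)"] Mc by auto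
      ultimately have "card (g ` {..<r} \<union> {v}) \<le> rank M"
        using card_lin_indpt_le_dim_span(2)[OF Mc, of "g ` {..<r} \<union> {v}"] unfolding rank_def by simp
      moreover have "card (g ` {..<r} \<union> {v}) = Suc r" using vg li(2) by simp
      ultimately show False using r by simp
    qed
  qed
qed

lemma krylov_stationary:
  fixes w :: "nat \<Rightarrow> nat \<Rightarrow> real"
  assumes w: "\<And>k i. i < n \<Longrightarrow> w (Suc k) i = (\<Sum>j<n. A i j * w k j)"
  shows "\<exists>c. \<forall>i<n. w k i = (\<Sum>l<n. c l * w l i)"
proof -
  have "minor (Suc n) (\<lambda>i j. if i < n then w j i else 0) = 0"
  proof (rule ccontr)
    assume nz: "\<not> ?thesis"
    show False
    proof (rule minor_matching[OF nz])
      fix p assume "\<And>i. i < Suc n \<Longrightarrow> (if i < n then w (p i) i else 0) \<noteq> 0"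
      from this[of n] show False by simp
    qed
  qed
  then obtain v where v: "\<exists>j<Suc n. v j \<noteq> 0"
      "\<And>i. i < Suc n \<Longrightarrow> (\<Sum>j<Suc n. (if i < n then w j i else 0) * v j) = 0"
    unfolding minor_eq_0_iff by blast
  define m where "m = (GREATEST j. j < Suc n \<and> v j \<noteq> 0)"
  have m: "m < Suc n \<and> v m \<noteq> 0"
    unfolding m_def using v(1) by (rule GreatestI_ex_nat[of _ n]) auto
  have max: "v j = 0" if "m < j" "j < Suc n" for j
    using Greatest_le_nat[of "\<lambda>j. j < Suc n \<and> v j \<noteq> 0" j n] that unfolding m_def by fastforce
  have rel: "w m i = (\<Sum>l<m. (- v l / v m) * w l i)" if i: "i < n" for i
  proof -
    have "0 = (\<Sum>j<Suc n. w j i * v j)" using v(2)[of i] i by simp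
    also have "\<dots> = (\<Sum>j<Suc m. w j i * v j)"
      using max m by (intro sum.mono_neutral_right) (auto simp: not_less)
    finally have "w m i * v m = - (\<Sum>l<m. w l i * v l)" by simp
    then have "w m i = - (\<Sum>l<m. w l i * v l) / v m" using m by (simp add: field_simps)
    then show ?thesis by (simp add: sum_divide_distrib sum_negf mult.commute)
  qed
  have next_ex: "\<exists>e. \<forall>i<n. w (Suc l) i = (\<Sum>j<m. e j * w j i)" if "l < m" for l
  proof (cases "Suc l = m")
    case True
    then show ?thesis using rel by (intro exI[of _ "\<lambda>l. - v l / v m"]) auto
  next
    case False
    then show ?thesis using that
      by (intro exI[of _ "\<lambda>j. of_bool (j = Suc l)"]) (auto simp: of_bool_def if_distrib[of "\<lambda>x. x * _"] cong: if_cong)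
  qed
  then obtain e where e: "\<And>l i. l < m \<Longrightarrow> i < n \<Longrightarrow> w (Suc l) i = (\<Sum>j<m. e l j * w j i)" by metis
  have "\<exists>c. \<forall>i<n. w k i = (\<Sum>l<m. c l * w l i)"
  proof (induction k)
    case 0
    show ?case
    proof (cases "m = 0")
      case True
      then show ?thesis using rel by auto
    next
      case False
      then show ?thesis
        by (intro exI[of _ "\<lambda>j. of_bool (j = 0)"]) (auto simp: of_bool_def if_distrib[of "\<lambda>x. x * _"] cong: if_cong)
    qed
  next
    case (Suc k)
    then obtain c where c: "\<And>i. i < n \<Longrightarrow> w k i = (\<Sum>l<m. c l * w l i)" by blast
    have "w (Suc k) i = (\<Sum>j<m. (\<Sum>l<m. c l * e l j) * w j i)" if i: "i < n" for i
    proof -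
      have "w (Suc k) i = (\<Sum>j<n. A i j * (\<Sum>l<m. c l * w l j))" using w[OF i] c by simp
      also have "\<dots> = (\<Sum>j<n. \<Sum>l<m. c l * (A i j * w l j))"
        by (simp add: sum_distrib_left mult.left_commute)
      also have "\<dots> = (\<Sum>l<m. c l * w (Suc l) i)"
        unfolding w[OF i] sum_distrib_left by (rule sum.swap)
      also have "\<dots> = (\<Sum>l<m. \<Sum>j<m. (c l * e l j) * w j i)"
        using e i by (intro sum.cong) (auto simp: sum_distrib_left mult.assoc)
      also have "\<dots> = (\<Sum>j<m. (\<Sum>l<m. c l * e l j) * w j i)"
        unfolding sum_distrib_right by (rule sum.swap)
      finally show ?thesis .
    qed
    then show ?case by (intro exI[of _ "\<lambda>j. \<Sum>l<m. c l * e l j"]) blast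
  qed
  then obtain c where c: "\<And>i. i < n \<Longrightarrow> w k i = (\<Sum>l<m. c l * w l i)" by blast
  have "(\<Sum>l<n. (if l < m then c l else 0) * w l i) = (\<Sum>l<m. c l * w l i)" for i
    using m by (intro sum.mono_neutral_cong_right) auto
  then show ?thesis using c by (intro exI[of _ "\<lambda>l. if l < m then c l else 0"]) auto
qed

section \<open>Polynomial functions\<close>

definition mon_eval :: "('v \<Rightarrow>\<^sub>0 nat) \<Rightarrow> ('v \<Rightarrow> real) \<Rightarrow> real" where
  "mon_eval a x = (\<Prod>v\<in>Poly_Mapping.keys a. x v ^ Poly_Mapping.lookup a v)"

lemma rpoly_eval_mon_eval:
  "rpoly_eval f x = (\<Sum>a\<in>Poly_Mapping.keys f. Poly_Mapping.lookup f a * mon_eval a x)"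
  unfolding rpoly_eval_def mon_eval_def ..

lemma mon_eval_superset:
  assumes "finite K" "Poly_Mapping.keys a \<subseteq> K"
  shows "mon_eval a x = (\<Prod>v\<in>K. x v ^ Poly_Mapping.lookup a v)"
  unfolding mon_eval_def using assms by (intro prod.mono_neutral_left) (auto simp: in_keys_iff)

lemma mon_eval_add: "mon_eval (a + b) x = mon_eval a x * mon_eval b x"
proof -
  let ?K = "Poly_Mapping.keys a \<union> Poly_Mapping.keys b"
  show ?thesis
    using mon_eval_superset[of ?K "a + b" x] mon_eval_superset[of ?K a x] mon_eval_superset[of ?K b x]
      keys_add[of a b]
    by (simp add: lookup_add power_add prod.distrib)
qed

lemma rpoly_eval_superset:
  assumes "finite K" "Poly_Mapping.keys f \<subseteq> K"
  shows "rpoly_eval f x = (\<Sum>a\<in>K. Poly_Mapping.lookup f a * mon_eval a x)"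
  unfolding rpoly_eval_mon_eval using assms by (intro sum.mono_neutral_left) (auto simp: in_keys_iff)

lemma rpoly_eval_add: "rpoly_eval (f + g) x = rpoly_eval f x + rpoly_eval g x"
proof -
  let ?K = "Poly_Mapping.keys f \<union> Poly_Mapping.keys g"
  show ?thesis
    using rpoly_eval_superset[of ?K "f + g" x] rpoly_eval_superset[of ?K f x] rpoly_eval_superset[of ?K g x]
      keys_add[of f g]
    by (simp add: lookup_add distrib_right sum.distrib)
qed

lemma rpoly_eval_single: "rpoly_eval (Poly_Mapping.single a c) x = c * mon_eval a x"
  using rpoly_eval_superset[of "{a}" "Poly_Mapping.single a c" x] by simp

lemma rpoly_eval_cong:
  assumes "\<And>v. v \<in> rpoly_vars f \<Longrightarrow> x v = y v"
  shows "rpoly_eval f x = rpoly_eval f y"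
proof -
  have "x v = y v" if "a \<in> Poly_Mapping.keys f" "v \<in> Poly_Mapping.keys a" for a v
    using that by (intro assms) (auto simp: rpoly_vars_def)
  then show ?thesis
    unfolding rpoly_eval_def by (intro sum.cong refl arg_cong2[of _ _ _ _ "(*)"] prod.cong) auto
qed

definition polyfun :: "'v set \<Rightarrow> (('v \<Rightarrow> real) \<Rightarrow> real) \<Rightarrow> bool" where
  "polyfun I F \<longleftrightarrow> (\<exists>f. rpoly_vars f \<subseteq> I \<and> (\<forall>x. rpoly_eval f x = F x))"

lemma polyfun_add:
  assumes "polyfun I F" "polyfun I G"
  shows "polyfun I (\<lambda>x. F x + G x)"
proof -
  obtain f g where fg: "rpoly_vars f \<subseteq> I" "\<forall>x. rpoly_eval f x = F x"
    "rpoly_vars g \<subseteq> I" "\<forall>x. rpoly_eval g x = G x"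
    using assms unfolding polyfun_def by blast
  have "rpoly_vars (f + g) \<subseteq> I"
    using fg(1,3) keys_add[of f g] unfolding rpoly_vars_def by blast
  then show ?thesis unfolding polyfun_def using fg(2,4) by (intro exI[of _ "f + g"]) (simp add: rpoly_eval_add)
qed

lemma polyfun_mon_eval:
  assumes "Poly_Mapping.keys a \<subseteq> I"
  shows "polyfun I (\<lambda>x. c * mon_eval a x)"
  unfolding polyfun_def using assms
  by (intro exI[of _ "Poly_Mapping.single a c"]) (auto simp: rpoly_eval_single rpoly_vars_def)

lemma polyfun_const: "polyfun I (\<lambda>_. c)"
  using polyfun_mon_eval[of 0 I c] by (simp add: mon_eval_def)

lemma polyfun_var: "v \<in> I \<Longrightarrow> polyfun I (\<lambda>x. x v)"
  using polyfun_mon_eval[of "Poly_Mapping.single v 1" I 1] by (simp add: mon_eval_def)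

lemma polyfun_sum:
  assumes "\<And>i. i \<in> S \<Longrightarrow> polyfun I (F i)"
  shows "polyfun I (\<lambda>x. \<Sum>i\<in>S. F i x)"
  using assms by (induction S rule: infinite_finite_induct) (auto intro: polyfun_const polyfun_add)

lemma polyfun_mult:
  assumes "polyfun I F" "polyfun I G"
  shows "polyfun I (\<lambda>x. F x * G x)"
proof -
  obtain f g where fg: "rpoly_vars f \<subseteq> I" "\<And>x. rpoly_eval f x = F x"
    "rpoly_vars g \<subseteq> I" "\<And>x. rpoly_eval g x = G x"
    using assms unfolding polyfun_def by blast
  have "(\<lambda>x. F x * G x) = (\<lambda>x. \<Sum>a\<in>Poly_Mapping.keys f. \<Sum>b\<in>Poly_Mapping.keys g.
      (Poly_Mapping.lookup f a * Poly_Mapping.lookup g b) * mon_eval (a + b) x)"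
    unfolding fg(2,4)[symmetric] rpoly_eval_mon_eval sum_product
    by (simp add: mon_eval_add mult_ac)
  moreover have "Poly_Mapping.keys (a + b) \<subseteq> I" if "a \<in> Poly_Mapping.keys f" "b \<in> Poly_Mapping.keys g" for a b
    using that fg(1,3) keys_add[of a b] unfolding rpoly_vars_def by blast
  ultimately show ?thesis by (auto intro!: polyfun_sum polyfun_mon_eval)
qed

lemma polyfun_prod:
  assumes "\<And>i. i \<in> S \<Longrightarrow> polyfun I (F i)"
  shows "polyfun I (\<lambda>x. \<Prod>i\<in>S. F i x)"
  using assms by (induction S rule: infinite_finite_induct) (auto intro: polyfun_const polyfun_mult)

lemma polyfun_minor:
  assumes "\<And>i j. i < r \<Longrightarrow> j < r \<Longrightarrow> polyfun I (\<lambda>x. F x i j)"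
  shows "polyfun I (\<lambda>x. minor r (F x))"
  unfolding minor_Leibniz
proof (intro polyfun_sum polyfun_mult polyfun_const polyfun_prod)
  fix p i assume "p \<in> {p. p permutes {0..<r}}" "i \<in> {0..<r}"
  then have "p i < r" "i < r" using permutes_in_image[of p "{0..<r}" i] by auto
  then show "polyfun I (\<lambda>x. F x i (p i))" using assms by blast
qed

lemma polyfun_restrict:
  assumes "polyfun I F"
  shows "F (restrict x I) = F x"
proof -
  obtain f where f: "rpoly_vars f \<subseteq> I" "\<And>x. rpoly_eval f x = F x"
    using assms unfolding polyfun_def by blast
  show ?thesis unfolding f(2)[symmetric] using f(1) by (intro rpoly_eval_cong) auto
qed

text \<open>Restricting to the line through two points reduces the claim to polynomials in one variable.\<close>

lemma polyfun_common_nonzero: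
  assumes F: "polyfun I F" "F a \<noteq> 0" and G: "polyfun I G" "G b \<noteq> 0"
  shows "\<exists>x. F x \<noteq> 0 \<and> G x \<noteq> 0"
proof -
  let ?l = "\<lambda>t v. a v + t * (b v - a v)"
  have line: "\<exists>p. \<forall>t. poly p t = H (?l t)" if H: "polyfun I H" for H
  proof -
    obtain f where f: "\<And>x. rpoly_eval f x = H x" using H unfolding polyfun_def by blast
    show ?thesis unfolding f[symmetric] rpoly_eval_def
      by (rule exI[of _ "\<Sum>m\<in>Poly_Mapping.keys f. Polynomial.smult (Poly_Mapping.lookup f m)
          (\<Prod>v\<in>Poly_Mapping.keys m. [:a v, b v - a v:] ^ Poly_Mapping.lookup m v)"])
        (simp add: poly_sum poly_prod)
  qed
  obtain p q where p: "\<And>t. poly p t = F (?l t)" and q: "\<And>t. poly q t = G (?l t)"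
    using line F(1) G(1) by meson
  have "poly p 0 \<noteq> 0" "poly q 1 \<noteq> 0" using p q F(2) G(2) by simp_all
  then have "p * q \<noteq> 0" by auto
  then have "finite {t. poly (p * q) t = 0}" by (rule poly_roots_finite)
  then obtain t where "poly (p * q) t \<noteq> 0"
    using ex_new_if_finite[OF infinite_UNIV_char_0[where 'a = real]] by blast
  then show ?thesis using p q by auto
qed

lemma proper_variety_nonzero:
  assumes "proper_variety I V"
  obtains F a where "polyfun I F" "F a \<noteq> 0" "\<And>x. x \<in> coord_space I \<Longrightarrow> F x \<noteq> 0 \<Longrightarrow> x \<notin> V"
proof -
  from assms obtain Fs where Fs: "\<forall>f\<in>Fs. rpoly_vars f \<subseteq> I"
      "V = {x \<in> coord_space I. \<forall>f\<in>Fs. rpoly_eval f x = 0}" "V \<noteq> coord_space I"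
    unfolding proper_variety_def variety_def by (elim conjE exE)
  from Fs(3) have "\<exists>a f. f \<in> Fs \<and> rpoly_eval f a \<noteq> 0"
    unfolding Fs(2) by (auto simp: set_eq_iff)
  then obtain a f where "f \<in> Fs" "rpoly_eval f a \<noteq> 0" by (elim exE conjE)
  show ?thesis
  proof (rule that)
    show "polyfun I (rpoly_eval f)" unfolding polyfun_def using Fs(1) \<open>f \<in> Fs\<close> by (intro exI[of _ f]) simp
    show "rpoly_eval f a \<noteq> 0" by fact
    show "x \<notin> V" if "rpoly_eval f x \<noteq> 0" for x unfolding Fs(2) using that \<open>f \<in> Fs\<close> by auto
  qed
qed

lemma proper_variety_polyfun:
  assumes "polyfun I F" "F a \<noteq> 0"
  shows "proper_variety I {x \<in> coord_space I. F x = 0}"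
proof -
  obtain f where f: "rpoly_vars f \<subseteq> I" "\<And>x. rpoly_eval f x = F x"
    using assms(1) unfolding polyfun_def by blast
  have "variety I {x \<in> coord_space I. F x = 0}"
    unfolding variety_def using f by (intro exI[of _ "{f}"]) auto
  moreover have "restrict a I \<in> coord_space I" unfolding coord_space_def by simp
  moreover have "restrict a I \<notin> {x \<in> coord_space I. F x = 0}"
    using assms(2) polyfun_restrict[OF assms(1), of a] by (simp only: mem_Collect_eq) simp
  ultimately show ?thesis unfolding proper_variety_def by metis
qed

section \<open>Generic rank of the controllability matrix\<close>

lemma append_cols_carrier [simp]:
  "A \<in> carrier_mat n a \<Longrightarrow> B \<in> carrier_mat n b \<Longrightarrow> append_cols A B \<in> carrier_mat n (a + b)"
  unfolding append_cols_def using mat_of_cols_carrier(1)[of n "cols A @ cols B"] by simp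

lemma append_cols_index:
  assumes "A \<in> carrier_mat n a" "B \<in> carrier_mat n b" "i < n" "j < a + b"
  shows "append_cols A B $$ (i,j) = (if j < a then A $$ (i,j) else B $$ (i, j - a))"
  unfolding append_cols_def using assms by (auto simp: mat_of_cols_index nth_append)

definition matching :: "entry mat \<Rightarrow> nat \<Rightarrow> bool" where
  "matching M k \<longleftrightarrow> (\<exists>r c. inj_on r {..<k} \<and> inj_on c {..<k} \<and>
     (\<forall>l<k. r l < dim_row M \<and> c l < dim_col M \<and> M $$ (r l, c l) = Star))"

lemma t_rank_Max: "t_rank M = Max {k. matching M k}"
  unfolding t_rank_def matching_def ..

lemma finite_matching: "finite {k. matching M k}"
proof -
  have "k \<le> dim_row M" if m: "matching M k" for k
  proof -
    obtain r where "inj_on r {..<k}" "\<forall>l<k. r l < dim_row M"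
      using m unfolding matching_def by blast
    moreover from this(2) have "r ` {..<k} \<subseteq> {..<dim_row M}" by auto
    ultimately show ?thesis using card_inj_on_le[of r "{..<k}" "{..<dim_row M}"] by simp
  qed
  then have "{k. matching M k} \<subseteq> {..dim_row M}" by blast
  then show ?thesis by (rule finite_subset) simp
qed

lemma matching_le_t_rank: "matching M k \<Longrightarrow> k \<le> t_rank M"
  unfolding t_rank_Max using finite_matching by (intro Max_ge) auto

lemma matching_t_rank: "matching M (t_rank M)"
proof -
  have "matching M 0" unfolding matching_def by simp
  then show ?thesis unfolding t_rank_Max using Max_in[OF finite_matching, of M] by blast
qed

lemma rank_le_t_rank:
  assumes M: "M \<in> carrier_mat n c" and P: "P \<in> carrier_mat n c"
    and supp: "\<And>i j. i < n \<Longrightarrow> j < c \<Longrightarrow> M $$ (i,j) \<noteq> 0 \<Longrightarrow> P $$ (i,j) = Star"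
  shows "vec_space.rank n (M :: real mat) \<le> t_rank P"
proof -
  interpret vec_space "TYPE(real)" n .
  obtain \<rho> \<gamma> where "inj_on \<rho> {..<rank M}" "inj_on \<gamma> {..<rank M}"
    "\<And>l. l < rank M \<Longrightarrow> \<rho> l < n \<and> \<gamma> l < c \<and> M $$ (\<rho> l, \<gamma> l) \<noteq> 0"
    using rank_matching[OF M] by metis
  then have "matching P (rank M)"
    unfolding matching_def using supp P by (intro exI[of _ \<rho>] exI[of _ \<gamma>]) auto
  then show ?thesis by (rule matching_le_t_rank)
qed

lemma (in vec_space) sum_in_span:
  assumes U: "U \<subseteq> carrier_vec n" and w: "\<And>l. l < (L::nat) \<Longrightarrow> vec n (w l) \<in> span U"
  shows "vec n (\<lambda>i. \<Sum>l<L. c l * w l i) \<in> span U"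
  using w
proof (induction L)
  case 0
  have "vec n (\<lambda>i. \<Sum>l<(0::nat). c l * w l i) = 0\<^sub>v n" by auto
  then show ?case using vectorspace.span_zero[OF vectorspace_axioms, of U] by (simp add: module_vec_simps)
next
  case (Suc L)
  have "vec n (\<lambda>i. \<Sum>l<Suc L. c l * w l i) = vec n (\<lambda>i. \<Sum>l<L. c l * w l i) + c L \<cdot>\<^sub>v vec n (w L)"
    by auto
  moreover have "c L \<cdot>\<^sub>v vec n (w L) \<in> span U" using smult_in_span[OF U] Suc.prems by simp
  moreover have "vec n (\<lambda>i. \<Sum>l<L. c l * w l i) \<in> span U" using Suc by simp
  ultimately show ?case using span_add1[OF U] by simp
qed

lemma pow_mat_Suc_left:
  assumes "A \<in> carrier_mat n n" "B \<in> carrier_mat n m"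
  shows "A ^\<^sub>m Suc k * B = A * (A ^\<^sub>m k * (B :: real mat))"
proof -
  have "A ^\<^sub>m k * A = A * A ^\<^sub>m k"
    using assms(1)
  proof (induction k)
    case (Suc k)
    then show ?case by (simp add: assoc_mult_mat[of A n n "A ^\<^sub>m k" n A n])
  qed auto
  then show ?thesis using assms by (simp add: assoc_mult_mat[of A n n "A ^\<^sub>m k" n B m])
qed

locale sym_pair =
  fixes A B :: "entry mat" and n m :: nat
  assumes carrier_A: "A \<in> carrier_mat n n" and carrier_B: "B \<in> carrier_mat n m"
    and sym_A: "sym_pattern A"
begin

definition star :: "nat \<Rightarrow> nat \<Rightarrow> bool" where
  "star i j \<longleftrightarrow> i < n \<and> j < n + m \<and> append_cols A B $$ (i,j) = Star"

definition wt :: "(param \<Rightarrow> real) \<Rightarrow> nat \<Rightarrow> nat \<Rightarrow> real" where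
  "wt x i j = (if star i j then if j < n then x (Inl (min i j, max i j)) else x (Inr (i, j - n)) else 0)"

abbreviation mat_A :: "(param \<Rightarrow> real) \<Rightarrow> real mat" where
  "mat_A x \<equiv> mat n n (\<lambda>(i,j). wt x i j)"

abbreviation mat_B :: "(param \<Rightarrow> real) \<Rightarrow> real mat" where
  "mat_B x \<equiv> mat n m (\<lambda>(i,u). wt x i (n + u))"

abbreviation "states \<equiv> {..<n}"
abbreviation "inputs \<equiv> {n..<n + m}"
abbreviation "verts \<equiv> states \<union> inputs"

lemma A_sym: "i < n \<Longrightarrow> j < n \<Longrightarrow> A $$ (i,j) = A $$ (j,i)"
  using sym_A carrier_A unfolding sym_pattern_def
  by (metis carrier_matD index_transpose_mat(1))

lemma star_A: "j < n \<Longrightarrow> star i j \<longleftrightarrow> i < n \<and> A $$ (i,j) = Star"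
  unfolding star_def using append_cols_index[OF carrier_A carrier_B, of i j] by auto

lemma star_B: "star i (n + u) \<longleftrightarrow> i < n \<and> u < m \<and> B $$ (i,u) = Star"
  unfolding star_def using append_cols_index[OF carrier_A carrier_B, of i "n + u"] by auto

lemma star_sym: "i < n \<Longrightarrow> j < n \<Longrightarrow> star i j \<Longrightarrow> star j i"
  using star_A A_sym by metis

lemma polyfun_wt: "polyfun (params A B) (\<lambda>x. wt x i j)"
proof (cases "star i j")
  case True
  show ?thesis
  proof (cases "j < n")
    case j: True
    then have "i < n" "A $$ (i,j) = Star" using True star_A by auto
    then have "A $$ (min i j, max i j) = Star" using A_sym[of i j] j by (auto simp: min_def max_def)
    then have "Inl (min i j, max i j) \<in> params A B"
      unfolding params_def using carrier_A \<open>i < n\<close> j by auto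
    then show ?thesis unfolding wt_def using True j by (auto intro: polyfun_var)
  next
    case False
    then obtain u where u: "j = n + u" using le_Suc_ex[of n j] by auto
    then have "Inr (i, j - n) \<in> params A B"
      unfolding params_def using True star_B carrier_B by auto
    then show ?thesis unfolding wt_def using True False by (auto intro: polyfun_var)
  qed
qed (simp add: wt_def polyfun_const)

lemma wt_surj:
  assumes "\<And>i j. i < n \<Longrightarrow> j < n \<Longrightarrow> M i j = M j i" "\<And>i j. M i j \<noteq> 0 \<Longrightarrow> star i j"
  obtains x where "wt x = M"
proof
  let ?x = "case_sum (\<lambda>(i,j). M i j) (\<lambda>(i,u). M i (n + u))"
  show "wt ?x = M"
  proof (intro ext)
    fix i j
    show "wt ?x i j = M i j"
    proof (cases "star i j")
      case True
      then have "i < n" unfolding star_def by simp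
      then show ?thesis using True assms(1)[of i j] by (auto simp: wt_def min_def max_def)
    qed (use assms(2) in \<open>auto simp: wt_def\<close>)
  qed
qed

lemma realization_mat:
  "sym_realization A (mat_A x)" "realization B (mat_B x)"
  "param_vec A B (mat_A x) (mat_B x) = restrict x (params A B)"
proof -
  have "wt x i j = wt x j i" if "i < n" "j < n" for i j
    using that star_sym[of i j] star_sym[of j i] by (auto simp: wt_def min.commute max.commute)
  then have "transpose_mat (mat_A x) = mat_A x" by (intro eq_matI) auto
  moreover have "realization A (mat_A x)"
    unfolding realization_def using carrier_A by (auto simp: wt_def star_A)
  ultimately show "sym_realization A (mat_A x)" unfolding sym_realization_def by simp
  show "realization B (mat_B x)"
    unfolding realization_def using carrier_B by (auto simp: wt_def star_B)
  show "param_vec A B (mat_A x) (mat_B x) = restrict x (params A B)"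
    unfolding param_vec_def
  proof (rule restrict_ext)
    fix v assume "v \<in> params A B"
    then consider i j where "v = Inl (i,j)" "i \<le> j" "j < n" "A $$ (i,j) = Star"
      | i u where "v = Inr (i,u)" "i < n" "u < m" "B $$ (i,u) = Star"
      unfolding params_def using carrier_A carrier_B by auto
    then show "case_sum (($$) (mat_A x)) (($$) (mat_B x)) v = x v"
      by cases (auto simp: wt_def star_A star_B)
  qed
qed

lemma realization_wt:
  assumes "sym_realization A A'" "realization B B'"
  shows "A' = mat_A (param_vec A B A' B')" "B' = mat_B (param_vec A B A' B')"
proof -
  have A': "A' \<in> carrier_mat n n" "\<And>i j. i < n \<Longrightarrow> j < n \<Longrightarrow> A $$ (i,j) = Fixed_Zero \<Longrightarrow> A' $$ (i,j) = 0"
    and sym: "transpose_mat A' = A'"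
    using assms(1) carrier_A unfolding sym_realization_def realization_def by auto
  have B': "B' \<in> carrier_mat n m" "\<And>i j. i < n \<Longrightarrow> j < m \<Longrightarrow> B $$ (i,j) = Fixed_Zero \<Longrightarrow> B' $$ (i,j) = 0"
    using assms(2) carrier_B unfolding realization_def by auto
  have A'sym: "A' $$ (i,j) = A' $$ (j,i)" if "i < n" "j < n" for i j
    using sym A'(1) that by (metis carrier_matD index_transpose_mat(1))
  have "A' $$ (i,j) = wt (param_vec A B A' B') i j" if ij: "i < n" "j < n" for i j
  proof (cases "A $$ (i,j) = Star")
    case True
    then have "A $$ (min i j, max i j) = Star" using A_sym[OF ij] by (auto simp: min_def max_def)
    then have "Inl (min i j, max i j) \<in> params A B" unfolding params_def using carrier_A ij by auto
    then show ?thesis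
      unfolding wt_def param_vec_def using True ij star_A A'sym[OF ij] by (auto simp: min_def max_def)
  next
    case False
    then have "A $$ (i,j) = Fixed_Zero" using entry.exhaust by blast
    then show ?thesis using A'(2) ij False star_A by (simp add: wt_def)
  qed
  then show "A' = mat_A (param_vec A B A' B')" using A'(1) by (intro eq_matI) auto
  have "B' $$ (i,u) = wt (param_vec A B A' B') i (n + u)" if iu: "i < n" "u < m" for i u
  proof (cases "B $$ (i,u) = Star")
    case True
    then have "Inr (i,u) \<in> params A B" unfolding params_def using carrier_B iu by auto
    then show ?thesis unfolding wt_def param_vec_def using True iu star_B by auto
  next
    case False
    then have "B $$ (i,u) = Fixed_Zero" using entry.exhaust by blast
    then show ?thesis using B'(2) iu False star_B by (simp add: wt_def)
  qed
  then show "B' = mat_B (param_vec A B A' B')" using B'(1) by (intro eq_matI) auto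
qed

lemma irreducible_connected:
  assumes irr: "irreducible_pair A B" and X: "X \<subset> states"
  shows "\<exists>y\<in>states - X. \<exists>x\<in>X \<union> inputs. star y x"
proof (rule ccontr)
  assume "\<not> ?thesis"
  then have no: "\<not> star y x" if "y < n" "y \<notin> X" "x \<in> X \<union> inputs" for x y using that by auto
  define p where "p = card X"
  have finX: "finite X" using X finite_subset by blast
  have p: "p < n" unfolding p_def using psubset_card_mono[OF _ X] by simp
  obtain xs where xs: "set xs = X" "distinct xs" using finite_distinct_list[OF finX] by blast
  obtain ys where ys: "set ys = states - X" "distinct ys" using finite_distinct_list[of "states - X"] by blast
  define zs where "zs = xs @ ys"
  have zs: "set zs = states" "distinct zs" unfolding zs_def using xs ys X by auto
  then have len: "length zs = n" using distinct_card[of zs] by simp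
  have lenx: "length xs = p" unfolding p_def using xs distinct_card by metis
  define \<pi> where "\<pi> i = (if i < n then zs ! i else i)" for i
  have "bij_betw (\<lambda>i. zs ! i) {..<n} states"
    by (rule bij_betw_nth[OF zs(2)]) (simp_all only: zs(1) len)
  then have "bij_betw \<pi> {..<n} states"
    using bij_betw_cong[of "{..<n}" \<pi> "(!) zs" states] by (simp add: \<pi>_def)
  then have perm: "\<pi> permutes {..<n}" by (rule bij_imp_permutes) (simp add: \<pi>_def)
  have low: "\<pi> i \<in> X" if "i < p" for i
    using that p lenx xs(1) nth_mem[of i xs] by (simp add: \<pi>_def zs_def nth_append)
  have high: "\<pi> i < n \<and> \<pi> i \<notin> X" if "p \<le> i" "i < n" for i
  proof -
    have "\<pi> i = ys ! (i - p)" "i - p < length ys"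
      using that lenx len by (auto simp: \<pi>_def zs_def nth_append)
    then have "\<pi> i \<in> set ys" by simp
    then show ?thesis using ys(1) by auto
  qed
  have Az: "A $$ (\<pi> i, \<pi> j) = Fixed_Zero" "A $$ (\<pi> j, \<pi> i) = Fixed_Zero" if "p \<le> i" "i < n" "j < p" for i j
  proof -
    have "\<pi> j < n" using low[OF that(3)] X by auto
    moreover have "\<not> star (\<pi> i) (\<pi> j)" using no high that low by blast
    ultimately have "A $$ (\<pi> i, \<pi> j) \<noteq> Star" using star_A high that by blast
    then show "A $$ (\<pi> i, \<pi> j) = Fixed_Zero" using entry.exhaust by blast
    then show "A $$ (\<pi> j, \<pi> i) = Fixed_Zero" using A_sym \<open>\<pi> j < n\<close> high that by metis
  qed
  have Bz: "B $$ (\<pi> i, u) = Fixed_Zero" if "p \<le> i" "i < n" "u < m" for i u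
  proof -
    have "\<not> star (\<pi> i) (n + u)" using no high that by auto
    then have "B $$ (\<pi> i, u) \<noteq> Star" using star_B high that by blast
    then show ?thesis using entry.exhaust by blast
  qed
  define A11 where "A11 = mat p p (\<lambda>(i,j). A $$ (\<pi> i, \<pi> j))"
  define A22 where "A22 = mat (n - p) (n - p) (\<lambda>(i,j). A $$ (\<pi> (i + p), \<pi> (j + p)))"
  define B1 where "B1 = mat p m (\<lambda>(i,u). B $$ (\<pi> i, u))"
  have "permute_both \<pi> A = four_block_mat A11 (0\<^sub>m p (n - p)) (0\<^sub>m (n - p) p) A22"
    unfolding permute_both_def A11_def A22_def using p carrier_A
    by (intro eq_matI) (auto simp: Az zero_entry_def)
  moreover have "permute_rows \<pi> B = B1 @\<^sub>r 0\<^sub>m (n - p) m"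
    unfolding permute_rows_def append_rows_def B1_def using p carrier_B
    by (intro eq_matI) (auto simp: Bz zero_entry_def)
  moreover have "A11 \<in> carrier_mat p p" "A22 \<in> carrier_mat (n - p) (n - p)" "B1 \<in> carrier_mat p m"
    unfolding A11_def A22_def B1_def by simp_all
  ultimately show False
    using irr perm p carrier_A carrier_B unfolding irreducible_pair_def Let_def by auto
qed

lemma walk_mat:
  assumes "i < n" "u < m"
  shows "walk verts (wt x) (Suc k) (n + u) i = (mat_A x ^\<^sub>m k * mat_B x) $$ (i,u)"
  using assms(1)
proof (induction k arbitrary: i)
  case 0
  have "walk verts (wt x) (Suc 0) (n + u) i = wt x i (n + u)"
    using assms(2) by (simp add: of_bool_def if_distrib[of "\<lambda>a. _ * a"] sum.delta cong: if_cong)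
  then show ?case using 0 assms(2) by simp
next
  case (Suc k)
  have zero: "walk verts (wt x) (Suc k) (n + u) j = 0" if "j \<in> inputs" for j
    using that by (auto simp: wt_def star_def intro!: sum.neutral)
  have "walk verts (wt x) (Suc (Suc k)) (n + u) i = (\<Sum>j<n. wt x i j * walk verts (wt x) (Suc k) (n + u) j)"
    unfolding walk.simps(2)[of _ _ "Suc k"] using zero
    by (intro sum.mono_neutral_right) auto
  also have "\<dots> = (\<Sum>j<n. wt x i j * (mat_A x ^\<^sub>m k * mat_B x) $$ (j,u))"
    using Suc.IH by (intro sum.cong) auto
  also have "\<dots> = (mat_A x * (mat_A x ^\<^sub>m k * mat_B x)) $$ (i,u)"
    using Suc.prems assms(2) by (simp add: scalar_prod_def atLeast0LessThan)
  finally show ?case by (simp only: pow_mat_Suc_left[OF mat_carrier mat_carrier])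
qed

lemma polyfun_walk: "polyfun (params A B) (\<lambda>x. walk verts (wt x) k u i)"
  by (induction k arbitrary: i) (auto intro!: polyfun_const polyfun_sum polyfun_mult polyfun_wt)

end

lemma matching_inj_on:
  assumes "matching M k"
  obtains R f where "R \<subseteq> {..<dim_row M}" "card R = k" "inj_on f R"
    "\<And>i. i \<in> R \<Longrightarrow> f i < dim_col M \<and> M $$ (i, f i) = Star"
proof -
  from assms obtain r c where rc: "inj_on r {..<k}" "inj_on c {..<k}"
    "\<forall>l<k. r l < dim_row M \<and> c l < dim_col M \<and> M $$ (r l, c l) = Star"
    unfolding matching_def by (elim exE conjE)
  define g where "g = inv_into {..<k} r"
  have g: "g (r l) = l" if "l < k" for l unfolding g_def using rc(1) that by simp
  show ?thesis
  proof (rule that[of "r ` {..<k}" "\<lambda>i. c (g i)"])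
    show "r ` {..<k} \<subseteq> {..<dim_row M}" using rc(3) by auto
    show "card (r ` {..<k}) = k" using rc(1) by (simp add: card_image)
    show "inj_on (\<lambda>i. c (g i)) (r ` {..<k})"
      using rc(2) g by (auto simp: inj_on_def)
    show "c (g i) < dim_col M \<and> M $$ (i, c (g i)) = Star" if "i \<in> r ` {..<k}" for i
      using that rc(3) g by auto
  qed
qed

context sym_pair
begin

lemma exists_matching_minor:
  "\<exists>N t \<tau> a. t_rank (append_cols A B) \<le> N \<and> (\<forall>i<N. t i < n \<and> \<tau> i < n + m) \<and>
    minor N (\<lambda>i j. wt a (t i) (\<tau> j)) \<noteq> 0"
proof -
  let ?P = "append_cols A B"
  have P: "?P \<in> carrier_mat n (n + m)" using carrier_A carrier_B by simp
  obtain R f where R: "R \<subseteq> states" "card R = t_rank ?P" "inj_on f R"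
    and f: "\<And>i. i \<in> R \<Longrightarrow> f i < n + m \<and> star i (f i)"
  proof (rule matching_inj_on[OF matching_t_rank[of ?P]])
    fix R f assume "R \<subseteq> {..<dim_row ?P}" "card R = t_rank ?P" "inj_on f R"
      "\<And>i. i \<in> R \<Longrightarrow> f i < dim_col ?P \<and> ?P $$ (i, f i) = Star"
    then show thesis using that[of R f] P unfolding star_def by auto
  qed
  have "\<exists>\<C> S. (\<forall>Y\<in>\<C>. Y \<subseteq> R \<union> f ` R \<inter> states \<and> cycle_set star Y) \<and> pairwise disjnt \<C> \<and>
    S \<subseteq> R \<and> f ` S \<subseteq> inputs \<and> S \<inter> \<Union>\<C> = {} \<and> card R \<le> card (\<Union>\<C>) + card S"
  proof (rule matching_cycle_sets[OF _ R(3,1)])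
    show "finite R" using R(1) finite_subset by blast
    show "f ` R \<subseteq> states \<union> inputs" using f by force
    show "star i (f i)" if "i \<in> R" for i using f[OF that] by simp
    show "star j i" if "i \<in> states" "j \<in> states" "star i j" for i j using that star_sym by simp
  qed auto
  then obtain \<C> S where C0: "\<forall>Y\<in>\<C>. Y \<subseteq> R \<union> f ` R \<inter> states \<and> cycle_set star Y"
    and disj: "pairwise disjnt \<C>" and S: "S \<subseteq> R" "f ` S \<subseteq> inputs" "S \<inter> \<Union>\<C> = {}"
    and cardR: "card R \<le> card (\<Union>\<C>) + card S"
    by (elim exE conjE)
  have C: "Y \<subseteq> states \<and> cycle_set star Y" if "Y \<in> \<C>" for Y using bspec[OF C0 that] R(1) by auto
  have finC: "finite (\<Union>\<C>)" using C finite_subset[of "\<Union>\<C>" states] by blast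
  then have fin: "finite \<C>" by (rule finite_UnionD)
  have weights: "\<exists>W :: nat \<Rightarrow> nat \<Rightarrow> real. (\<forall>i j. W i j = W j i) \<and> (\<forall>i j. W i j \<noteq> 0 \<longrightarrow> i \<in> Y \<and> j \<in> Y \<and> star i j) \<and>
      (\<forall>v. (\<forall>b\<in>Y. (\<Sum>s\<in>Y. W b s * v s) = 0) \<longrightarrow> (\<forall>s\<in>Y. v s = 0))" if Y: "Y \<in> \<C>" for Y
  proof (cases "Y = {}")
    case True
    then show ?thesis by (intro exI[of _ "\<lambda>_ _. 0"]) simp
  next
    case False
    then obtain y where y: "y \<in> Y" by blast
    have finY: "finite Y" by (rule finite_subset[OF Union_upper[OF Y] finC])
    have "star j i" if "i \<in> Y" "j \<in> Y" "star i j" for i j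
      using that C[OF Y] star_sym[of i j] by auto
    then have "\<exists>W z. (\<forall>i j. W i j = W j i) \<and> (\<forall>i j. W i j \<noteq> 0 \<longrightarrow> i \<in> Y \<and> j \<in> Y \<and> star i j) \<and>
      bij_betw z {..<card Y} Y \<and> minor (card Y) (\<lambda>i j. W (z i) (z j)) \<noteq> 0 \<and>
      (\<forall>K. minor (card Y) (\<lambda>i l. walk Y W (K + l) y (z i)) \<noteq> 0)"
      using C[OF Y] finY y by (intro cycle_set_weights) auto
    then obtain W z where W: "\<forall>i j. W i j = W j i" "\<forall>i j. W i j \<noteq> 0 \<longrightarrow> i \<in> Y \<and> j \<in> Y \<and> star i j"
      and z: "bij_betw z {..<card Y} Y" "minor (card Y) (\<lambda>i j. W (z i) (z j)) \<noteq> 0"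
      by (elim exE conjE)
    have "v s = 0" if eq: "\<forall>b\<in>Y. (\<Sum>s\<in>Y. W b s * v s) = 0" and s: "s \<in> Y" for v s
    proof -
      have sums: "(\<Sum>j<card Y. W (z i) (z j) * v (z j)) = 0" if "i < card Y" for i
      proof -
        have "z i \<in> Y" using z(1) that by (auto simp: bij_betw_def)
        then show ?thesis using eq sum.reindex_bij_betw[OF z(1), of "\<lambda>s. W (z i) s * v s"] by simp
      qed
      have zero: "v (z j) = 0" if "j < card Y" for j
      proof (rule ccontr)
        assume "v (z j) \<noteq> 0"
        then have "minor (card Y) (\<lambda>i j. W (z i) (z j)) = 0"
          unfolding minor_eq_0_iff using that sums by (intro exI[of _ "\<lambda>j. v (z j)"]) auto
        then show False using z(2) by simp
      qed
      have "s \<in> z ` {..<card Y}" using z(1) s by (simp add: bij_betw_def)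
      then obtain j where "j < card Y" "z j = s" by auto
      then show ?thesis using zero by blast
    qed
    then have "\<forall>v. (\<forall>b\<in>Y. (\<Sum>s\<in>Y. W b s * v s) = 0) \<longrightarrow> (\<forall>s\<in>Y. v s = 0)" by blast
    with W show ?thesis by (intro exI conjI)
  qed
  then have "\<forall>Y\<in>\<C>. \<exists>W :: nat \<Rightarrow> nat \<Rightarrow> real. (\<forall>i j. W i j = W j i) \<and>
      (\<forall>i j. W i j \<noteq> 0 \<longrightarrow> i \<in> Y \<and> j \<in> Y \<and> star i j) \<and>
      (\<forall>v. (\<forall>b\<in>Y. (\<Sum>s\<in>Y. W b s * v s) = 0) \<longrightarrow> (\<forall>s\<in>Y. v s = 0))"
    by (intro ballI)
  from bchoice[OF this] obtain W :: "nat set \<Rightarrow> nat \<Rightarrow> nat \<Rightarrow> real"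
    where W: "\<forall>Y\<in>\<C>. (\<forall>i j. W Y i j = W Y j i) \<and>
      (\<forall>i j. W Y i j \<noteq> 0 \<longrightarrow> i \<in> Y \<and> j \<in> Y \<and> star i j) \<and>
      (\<forall>v. (\<forall>b\<in>Y. (\<Sum>s\<in>Y. W Y b s * v s) = 0) \<longrightarrow> (\<forall>s\<in>Y. v s = 0))"
    by (elim exE)
  have Wsym: "W Y i j = W Y j i" if "Y \<in> \<C>" for Y i j
    using conjunct1[OF bspec[OF W that]] by (elim allE)
  have Wsupp: "i \<in> Y \<and> j \<in> Y \<and> star i j" if "Y \<in> \<C>" "W Y i j \<noteq> 0" for Y i j
    using conjunct1[OF conjunct2[OF bspec[OF W that(1)]]] that(2) by (elim allE impE)
  have Wker: "v s = 0" if "Y \<in> \<C>" "\<And>b. b \<in> Y \<Longrightarrow> (\<Sum>s\<in>Y. W Y b s * v s) = 0" "s \<in> Y" for Y v s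
    using conjunct2[OF conjunct2[OF bspec[OF W that(1)]], rule_format, OF that(2,3)] .
  define M where "M i j = (\<Sum>Y\<in>\<C>. W Y i j) + of_bool (i \<in> S \<and> j = f i)" for i j
  have "M i j = M j i" if "i < n" "j < n" for i j
  proof -
    have "\<not> (i \<in> S \<and> j = f i)" "\<not> (j \<in> S \<and> i = f j)" using S(2) that by auto
    moreover have "(\<Sum>Y\<in>\<C>. W Y i j) = (\<Sum>Y\<in>\<C>. W Y j i)" using Wsym by (intro sum.cong) auto
    ultimately show ?thesis unfolding M_def by auto
  qed
  moreover have "star i j" if "M i j \<noteq> 0" for i j
  proof (cases "i \<in> S \<and> j = f i")
    case True
    then show ?thesis using f S(1) by blast
  next
    case False
    then have "(\<Sum>Y\<in>\<C>. W Y i j) \<noteq> 0" using that unfolding M_def by auto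
    then obtain Y where "Y \<in> \<C>" "W Y i j \<noteq> 0" by (rule sum.not_neutral_contains_not_neutral)
    then show ?thesis using Wsupp by blast
  qed
  ultimately obtain a where a: "wt a = M" using wt_surj[of M] by blast
  define T where "T = \<Union>\<C> \<union> S"
  define \<sigma> where "\<sigma> s = (if s \<in> S then f s else s)" for s
  have Tn: "T \<subseteq> states" unfolding T_def using Union_least[of \<C> states] C S(1) R(1) by auto
  have finS: "finite S" using finite_subset[OF subset_trans[OF S(1) R(1)]] by simp
  have finT: "finite T" unfolding T_def using finC finS by simp
  have MS: "M b (\<sigma> s) = of_bool (s = b)" if b: "b \<in> S" and s: "s \<in> T" for b s
  proof -
    have "W Y b j = 0" if "Y \<in> \<C>" for Y j using Wsupp[OF that, of b j] b S(3) that by blast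
    then have "M b (\<sigma> s) = of_bool (\<sigma> s = f b)" unfolding M_def using b by simp
    also have "\<sigma> s = f b \<longleftrightarrow> s = b"
    proof (cases "s \<in> S")
      case True
      then show ?thesis unfolding \<sigma>_def using b S(1) R(3) by (auto simp: inj_on_def)
    next
      case False
      then show ?thesis unfolding \<sigma>_def using b S(2) s Tn by force
    qed
    finally show ?thesis .
  qed
  have MY: "M b s = W Y b s" if "Y \<in> \<C>" "b \<in> Y" for Y b s
  proof -
    have "W Y' b s = 0" if "Y' \<in> \<C> - {Y}" for Y'
    proof (rule ccontr)
      assume "W Y' b s \<noteq> 0"
      then have "b \<in> Y'" using Wsupp that by blast
      then show False using disj that \<open>Y \<in> \<C>\<close> \<open>b \<in> Y\<close> unfolding pairwise_def disjnt_def by blast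
    qed
    then have "(\<Sum>Y\<in>\<C>. W Y b s) = W Y b s"
      using sum.remove[OF fin that(1), of "\<lambda>Y. W Y b s"] by simp
    moreover have "b \<notin> S" using that S(3) by blast
    ultimately show ?thesis unfolding M_def by simp
  qed
  have ker: "u s = 0" if eq: "\<And>b. b \<in> T \<Longrightarrow> (\<Sum>s\<in>T. M b (\<sigma> s) * u s) = 0" and s: "s \<in> T" for u s
  proof -
    have uS: "u b = 0" if b: "b \<in> S" for b
    proof -
      have bT: "b \<in> T" unfolding T_def using b by blast
      have "0 = (\<Sum>s\<in>T. of_bool (s = b) * u s)" using eq[OF bT] MS[OF b] by simp
      also have "\<dots> = (\<Sum>s\<in>T. if s = b then u s else 0)" by (intro sum.cong) auto
      finally show ?thesis using bT finT by simp
    qed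
    have "u s = 0" if Y: "Y \<in> \<C>" and s: "s \<in> Y" for Y s
    proof (rule Wker[OF Y _ s])
      fix b assume b: "b \<in> Y"
      have bT: "b \<in> T" and YT: "Y \<subseteq> T" unfolding T_def using b Y by blast+
      have "(\<Sum>s\<in>T. M b (\<sigma> s) * u s) = (\<Sum>s\<in>Y. W Y b s * u s)"
      proof (rule sum.mono_neutral_cong_right[OF finT YT])
        show "\<forall>s\<in>T - Y. M b (\<sigma> s) * u s = 0"
        proof
          fix s assume s: "s \<in> T - Y"
          show "M b (\<sigma> s) * u s = 0"
          proof (cases "s \<in> S")
            case True
            then show ?thesis using uS by simp
          next
            case False
            moreover have "W Y b s = 0" using Wsupp[OF Y, of b s] s by blast
            ultimately show ?thesis using MY[OF Y b] by (simp add: \<sigma>_def)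
          qed
        qed
        show "M b (\<sigma> s) * u s = W Y b s * u s" if "s \<in> Y" for s
        proof -
          have "s \<notin> S" using that Y S(3) by blast
          then show ?thesis using MY[OF Y b] by (simp add: \<sigma>_def)
        qed
      qed
      then show "(\<Sum>s\<in>Y. W Y b s * u s) = 0" using eq[OF bT] by simp
    qed
    then show ?thesis using uS s unfolding T_def by blast
  qed
  obtain t where t: "bij_betw t {0..<card T} T" using ex_bij_betw_nat_finite[OF finT] by blast
  then have t: "bij_betw t {..<card T} T" by (simp add: atLeast0LessThan)
  define w where "w = inv_into {..<card T} t"
  have tT: "t i \<in> T" if "i < card T" for i using t that by (auto simp: bij_betw_def)
  have wt: "w (t i) = i" if "i < card T" for i
    unfolding w_def using t that by (auto simp: bij_betw_def)
  have "minor (card T) (\<lambda>i j. M (t i) (\<sigma> (t j))) \<noteq> 0"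
  proof
    assume "minor (card T) (\<lambda>i j. M (t i) (\<sigma> (t j))) = 0"
    then obtain v k where v: "k < card T" "v k \<noteq> 0"
      "\<And>i. i < card T \<Longrightarrow> (\<Sum>j<card T. M (t i) (\<sigma> (t j)) * v j) = 0"
      unfolding minor_eq_0_iff by blast
    have "v (w (t k)) = 0"
    proof (rule ker[of "\<lambda>s. v (w s)"])
      fix b assume "b \<in> T"
      then have "b \<in> t ` {..<card T}" using bij_betw_imp_surj_on[OF t] by simp
      then obtain i where i: "i < card T" "t i = b" by auto
      have "(\<Sum>s\<in>T. M b (\<sigma> s) * v (w s)) = (\<Sum>j<card T. M b (\<sigma> (t j)) * v (w (t j)))"
        by (rule sum.reindex_bij_betw[OF t, symmetric])
      also have "\<dots> = (\<Sum>j<card T. M b (\<sigma> (t j)) * v j)" using wt by (intro sum.cong) auto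
      finally show "(\<Sum>s\<in>T. M b (\<sigma> s) * v (w s)) = 0" using v(3)[OF i(1)] i(2) by simp
    qed (use tT v(1) in blast)
    then show False using v(1,2) wt by simp
  qed
  moreover have "card T = card (\<Union>\<C>) + card S"
    unfolding T_def using finC finS S(3) by (simp add: card_Un_disjoint Int_commute)
  moreover have "t i < n" "\<sigma> (t i) < n + m" if "i < card T" for i
  proof -
    show "t i < n" using tT[OF that] Tn by auto
    then show "\<sigma> (t i) < n + m" unfolding \<sigma>_def using f S(1) by auto
  qed
  ultimately show ?thesis
    using R(2) cardR a by (intro exI[of _ "card T"] exI[of _ t] exI[of _ "\<lambda>i. \<sigma> (t i)"] exI[of _ a]) auto
qed

lemma exists_krylov_minor:
  assumes "irreducible_pair A B"
  shows "\<exists>r \<kappa> \<mu> c a. t_rank A \<le> r \<and> (\<forall>l<r. 2 \<le> \<kappa> l \<and> \<mu> l \<in> inputs \<and> c l < n) \<and>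
    minor r (\<lambda>i l. walk verts (wt a) (\<kappa> l) (\<mu> l) (c i)) \<noteq> 0"
proof -
  obtain R f where R: "R \<subseteq> states" "card R = t_rank A" "inj_on f R"
    and f: "\<And>i. i \<in> R \<Longrightarrow> f i < n \<and> star i (f i)"
  proof (rule matching_inj_on[OF matching_t_rank[of A]])
    fix R f assume "R \<subseteq> {..<dim_row A}" "card R = t_rank A" "inj_on f R"
      "\<And>i. i \<in> R \<Longrightarrow> f i < dim_col A \<and> A $$ (i, f i) = Star"
    then show thesis using that[of R f] carrier_A star_A by auto
  qed
  have "\<exists>\<C> S. (\<forall>Y\<in>\<C>. Y \<subseteq> R \<union> f ` R \<inter> states \<and> cycle_set star Y) \<and> pairwise disjnt \<C> \<and>
    S \<subseteq> R \<and> f ` S \<subseteq> inputs \<and> S \<inter> \<Union>\<C> = {} \<and> card R \<le> card (\<Union>\<C>) + card S"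
  proof (rule matching_cycle_sets[OF _ R(3,1)])
    show "finite R" using R(1) finite_subset by blast
    show "f ` R \<subseteq> states \<union> inputs" using f by force
    show "star i (f i)" if "i \<in> R" for i using f[OF that] by simp
    show "star j i" if "i \<in> states" "j \<in> states" "star i j" for i j using that star_sym by simp
  qed auto
  then obtain \<C> S where C0: "\<forall>Y\<in>\<C>. Y \<subseteq> R \<union> f ` R \<inter> states \<and> cycle_set star Y"
    and disj: "pairwise disjnt \<C>" and S: "S \<subseteq> R" "f ` S \<subseteq> inputs"
    and cardR: "card R \<le> card (\<Union>\<C>) + card S"
    by (elim exE conjE)
  have C: "Y \<subseteq> states \<and> cycle_set star Y" if "Y \<in> \<C>" for Y using bspec[OF C0 that] R(1) by auto
  have "S = {}" using S f by force
  have "\<exists>M \<kappa> \<mu> c. grown star states inputs states (card (\<Union>\<C>)) M \<kappa> \<mu> c"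
  proof (rule grown_exists)
    show "star j i" if "i \<in> states" "j \<in> states" "star i j" for i j using that star_sym by simp
    show "\<exists>y\<in>states - X. \<exists>x\<in>X \<union> inputs. star y x" if "X \<subset> states" for X
      using irreducible_connected[OF assms that] .
  qed (use C disj in auto)
  then obtain M \<kappa> \<mu> c where g: "grown star states inputs states (card (\<Union>\<C>)) M \<kappa> \<mu> c" by (elim exE)
  have M: "\<And>i j. i < n \<Longrightarrow> j < n \<Longrightarrow> M i j = M j i" "\<And>i j. M i j \<noteq> 0 \<Longrightarrow> star i j"
    and idx: "\<forall>l<card (\<Union>\<C>). 2 \<le> \<kappa> l \<and> \<mu> l \<in> inputs \<and> c l < n"
    and full: "minor (card (\<Union>\<C>)) (\<lambda>i l. walk verts M (\<kappa> l) (\<mu> l) (c i)) \<noteq> 0"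
    using g unfolding grown_def by auto
  obtain a where a: "wt a = M" using wt_surj[of M] M by blast
  show ?thesis
    by (intro exI[of _ "card (\<Union>\<C>)"] exI[of _ \<kappa>] exI[of _ \<mu>] exI[of _ c] exI[of _ a])
      (use R(2) cardR \<open>S = {}\<close> idx full a in auto)
qed

lemma set_cols_ctrl_mat:
  assumes "A' \<in> carrier_mat n n" "B' \<in> carrier_mat n m"
  shows "ctrl_mat A' B' \<in> carrier_mat n (length (concat (map (\<lambda>k. cols (A' ^\<^sub>m k * B')) [0..<n])))"
    "set (cols (ctrl_mat A' B')) = (\<Union>k<n. set (cols (A' ^\<^sub>m k * B')))"
proof -
  have "set (cols (A' ^\<^sub>m k * B')) \<subseteq> carrier_vec n" for k
    using cols_dim[of "A' ^\<^sub>m k * B'"] assms by (simp add: carrier_matD[OF pow_carrier_mat])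
  then have "set (concat (map (\<lambda>k. cols (A' ^\<^sub>m k * B')) [0..<n])) \<subseteq> carrier_vec n" by auto
  then have "cols (ctrl_mat A' B') = concat (map (\<lambda>k. cols (A' ^\<^sub>m k * B')) [0..<n])"
    unfolding ctrl_mat_def using assms by (simp add: cols_mat_of_cols)
  then show "set (cols (ctrl_mat A' B')) = (\<Union>k<n. set (cols (A' ^\<^sub>m k * B')))"
    by (auto simp: atLeast0LessThan)
  show "ctrl_mat A' B' \<in> carrier_mat n (length (concat (map (\<lambda>k. cols (A' ^\<^sub>m k * B')) [0..<n])))"
    unfolding ctrl_mat_def using assms mat_of_cols_carrier(1)[of n] by simp
qed

lemma rank_ctrl_mat:
  assumes F1: "minor N (\<lambda>i j. wt x (t i) (\<tau> j)) \<noteq> 0" "\<And>i. i < N \<Longrightarrow> t i < n \<and> \<tau> i < n + m"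
      "t_rank (append_cols A B) \<le> N"
    and F2: "minor r (\<lambda>i l. walk verts (wt x) (\<kappa> l) (\<mu> l) (c i)) \<noteq> 0"
      "\<And>l. l < r \<Longrightarrow> 2 \<le> \<kappa> l \<and> \<mu> l \<in> inputs \<and> c l < n" "t_rank A \<le> r"
  shows "vec_space.rank n (ctrl_mat (mat_A x) (mat_B x)) = t_rank (append_cols A B)"
proof -
  interpret vec_space "TYPE(real)" n .
  let ?A = "mat_A x" and ?B = "mat_B x" and ?P = "append_cols A B"
  let ?K = "ctrl_mat ?A ?B"
  define M where "M = mat n (n + m) (\<lambda>(i,j). wt x i j)"
  have A: "?A \<in> carrier_mat n n" and B: "?B \<in> carrier_mat n m" and M: "M \<in> carrier_mat n (n + m)"
    unfolding M_def by simp_all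
  have P: "?P \<in> carrier_mat n (n + m)" using carrier_A carrier_B by simp
  note K = set_cols_ctrl_mat[OF A B]
  have AB: "?A ^\<^sub>m k * ?B \<in> carrier_mat n m" for k
    using mult_carrier_mat[OF pow_carrier_mat[OF A] B] .
  have cM: "set (cols M) \<subseteq> carrier_vec n" using cols_dim[of M] M by simp
  have cK: "set (cols ?K) \<subseteq> carrier_vec n" using cols_dim[of ?K] K(1) by auto
  have colM: "col M j = (if j < n then col ?A j else col ?B (j - n))" if "j < n + m" for j
    using that unfolding M_def by (intro eq_vecI) auto
  have cols: "set (cols X) = {col X j |j. j < dim_col X}" for X :: "real mat"
    unfolding cols_def by auto
  have setM: "set (cols M) = set (cols ?A) \<union> set (cols ?B)"
  proof -
    show ?thesis
    proof (intro equalityI subsetI)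
      fix v assume "v \<in> set (cols M)"
      then obtain j where "v = col M j" "j < n + m" unfolding cols using M by auto
      then have "v = col ?A j \<and> j < dim_col ?A \<or> v = col ?B (j - n) \<and> j - n < dim_col ?B"
        using colM[of j] by (cases "j < n") auto
      then show "v \<in> set (cols ?A) \<union> set (cols ?B)" unfolding cols by blast
    next
      fix v assume "v \<in> set (cols ?A) \<union> set (cols ?B)"
      then consider j where "v = col ?A j" "j < n" | u where "v = col ?B u" "u < m"
        unfolding cols by auto
      then show "v \<in> set (cols M)"
      proof cases
        case (1 j)
        then have "v = col M j" "j < dim_col M" using colM[of j] M by auto
        then show ?thesis unfolding cols by blast
      next
        case (2 u)
        then have "v = col M (n + u)" "n + u < dim_col M" using colM[of "n + u"] M by auto
        then show ?thesis unfolding cols by blast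
      qed
    qed
  qed
  have mult_in: "?A *\<^sub>v y \<in> span (set (cols ?A))" if "y \<in> carrier_vec n" for y
    using col_space_eq[OF A] that mult_mat_vec_carrier[OF A that] unfolding col_space_def by auto
  have col_step: "col (?A ^\<^sub>m Suc k * ?B) u = ?A *\<^sub>v col (?A ^\<^sub>m k * ?B) u" if "u < m" for k u
    unfolding pow_mat_Suc_left[OF A B] using that by (intro col_mult2[OF A AB])
  have col_in_A: "col (?A ^\<^sub>m Suc k * ?B) u \<in> span (set (cols ?A))" if "u < m" for k u
    unfolding col_step[OF that] using that AB[of k] by (intro mult_in) (simp add: carrier_vecI)
  have "set (cols ?K) \<subseteq> span (set (cols M))"
  proof
    fix v assume "v \<in> set (cols ?K)"
    then obtain k where "v \<in> set (cols (?A ^\<^sub>m k * ?B))" unfolding K(2) by blast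
    then obtain u where v: "v = col (?A ^\<^sub>m k * ?B) u" "u < m"
      unfolding cols using carrier_matD(2)[OF AB] by auto
    show "v \<in> span (set (cols M))"
    proof (cases k)
      case 0
      then have "v = col ?B u" using v(1) left_mult_one_mat[OF B] by simp
      with v(2) have "v \<in> set (cols ?B)"
        unfolding cols by (intro CollectI exI[of _ u] conjI) simp_all
      then have "v \<in> set (cols M)" unfolding setM by blast
      then show ?thesis using in_own_span[of "set (cols M)"] cM by auto
    next
      case (Suc k')
      then have "v \<in> span (set (cols ?A))" using v col_in_A by simp
      moreover have "span (set (cols ?A)) \<subseteq> span (set (cols M))"
        by (rule span_is_monotone) (simp add: setM)
      ultimately show ?thesis by blast
    qed
  qed
  then have "rank ?K \<le> rank M" by (rule rank_mono[OF K(1) M])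
  also have "rank M \<le> t_rank ?P"
    by (rule rank_le_t_rank[OF M P]) (auto simp: M_def wt_def star_def split: if_splits)
  finally have upper: "rank ?K \<le> t_rank ?P" .
  have krylov: "col (?A ^\<^sub>m k * ?B) u \<in> span (set (cols ?K))" if u: "u < m" for k u
  proof -
    define w where "w k i = (?A ^\<^sub>m k * ?B) $$ (i,u)" for k i
    have colw: "col (?A ^\<^sub>m k * ?B) u = vec n (w k)" for k
      unfolding w_def using AB[of k] u by (intro eq_vecI) auto
    have "w (Suc k) i = (\<Sum>j<n. wt x i j * w k j)" if "i < n" for k i
      unfolding w_def pow_mat_Suc_left[OF A B] using that u AB[of k]
      by (simp add: scalar_prod_def atLeast0LessThan del: index_mult_mat(2,3)) 
    then obtain d where d: "\<And>i. i < n \<Longrightarrow> w k i = (\<Sum>l<n. d l * w l i)"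
      using krylov_stationary[of n w "wt x" k] by blast
    have "vec n (w l) \<in> span (set (cols ?K))" if "l < n" for l
    proof -
      have "u < dim_col (?A ^\<^sub>m l * ?B)" unfolding carrier_matD(2)[OF AB] by (rule u)
      then have "vec n (w l) \<in> set (cols (?A ^\<^sub>m l * ?B))"
        unfolding cols colw[symmetric] by (intro CollectI exI[of _ u] conjI refl)
      with that have "vec n (w l) \<in> set (cols ?K)" unfolding K(2) by (intro UN_I[of l]) simp_all
      then show ?thesis using in_own_span[of "set (cols ?K)"] cK by auto
    qed
    then have "vec n (\<lambda>i. \<Sum>l<n. d l * w l i) \<in> span (set (cols ?K))" by (rule sum_in_span[OF cK])
    moreover have "vec n (w k) = vec n (\<lambda>i. \<Sum>l<n. d l * w l i)" using d by auto
    ultimately show ?thesis unfolding colw by simp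
  qed
  define g where "g l = col (?A ^\<^sub>m (\<kappa> l - 1) * ?B) (\<mu> l - n)" for l
  have g: "g l \<in> span (set (cols ?A))" "g l \<in> span (set (cols ?K))" if "l < r" for l
  proof -
    have u: "\<mu> l - n < m" and k: "\<kappa> l - 1 = Suc (\<kappa> l - 2)" using F2(2)[OF that] by auto
    show "g l \<in> span (set (cols ?A))" unfolding g_def k by (rule col_in_A[OF u])
    show "g l \<in> span (set (cols ?K))" unfolding g_def by (rule krylov[OF u])
  qed
  have "g l $ c i = walk verts (wt x) (\<kappa> l) (\<mu> l) (c i)" if "i < r" "l < r" for i l
  proof -
    have u: "\<mu> l - n < m" "n + (\<mu> l - n) = \<mu> l" and k: "\<kappa> l = Suc (\<kappa> l - 1)" and ci: "c i < n"
      using F2(2)[OF that(2)] F2(2)[OF that(1)] by auto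
    have "walk verts (wt x) (\<kappa> l) (\<mu> l) (c i) = (?A ^\<^sub>m (\<kappa> l - 1) * ?B) $$ (c i, \<mu> l - n)"
      using walk_mat[OF ci u(1), of x "\<kappa> l - 1"] u(2) k by simp
    then show ?thesis unfolding g_def using ci u(1) AB[of "\<kappa> l - 1"] by simp
  qed
  then have gm: "minor r (\<lambda>i l. g l $ c i) \<noteq> 0" using F2(1) minor_cong[of r] by (metis (no_types, lifting))
  have "rank ?A \<le> t_rank A"
    by (rule rank_le_t_rank[OF A carrier_A]) (auto simp: wt_def star_A split: if_splits)
  then have rA: "rank ?A \<le> r" using F2(3) by simp
  have "set (cols ?A) \<subseteq> span (g ` {..<r})"
    by (rule minor_spans_cols[OF A rA g(1) _ gm]) (use F2(2) in auto)
  also have "span (g ` {..<r}) \<subseteq> span (set (cols ?K))"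
    by (rule span_subsetI[OF cK]) (use g(2) in auto)
  finally have A_in: "set (cols ?A) \<subseteq> span (set (cols ?K))" .
  have "set (cols ?B) \<subseteq> span (set (cols ?K))"
  proof
    fix v assume "v \<in> set (cols ?B)"
    then obtain u where "u < m" "v = col ?B u" unfolding cols_def by auto
    then show "v \<in> span (set (cols ?K))" using krylov[of u 0] left_mult_one_mat[OF B] by simp
  qed
  then have M_in: "set (cols M) \<subseteq> span (set (cols ?K))" using A_in setM by simp
  have "N \<le> rank ?K"
  proof (rule rank_ge_minor[OF K(1)])
    show "col M (\<tau> j) \<in> span (set (cols ?K))" if "j < N" for j
      using M_in F1(2)[OF that] M unfolding cols_def by auto
    show "t i < n" if "i < N" for i using F1(2)[OF that] by simp
    have "minor N (\<lambda>i j. col M (\<tau> j) $ t i) = minor N (\<lambda>i j. wt x (t i) (\<tau> j))"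
      using F1(2) by (intro minor_cong) (simp add: M_def)
    then show "minor N (\<lambda>i j. col M (\<tau> j) $ t i) \<noteq> 0" using F1(1) by simp
  qed
  then show ?thesis using upper F1(3) by simp
qed

lemma is_generic_ctrl_dim_unique:
  assumes "is_generic_ctrl_dim A B d1" "is_generic_ctrl_dim A B d2"
  shows "d1 = d2"
proof -
  let ?rk = "\<lambda>x. vec_space.rank n (ctrl_mat (mat_A x) (mat_B x))"
  have nonzero: "\<exists>F a. polyfun (params A B) F \<and> F a \<noteq> 0 \<and> (\<forall>x. F x \<noteq> 0 \<longrightarrow> ?rk x = d)"
    if gd: "is_generic_ctrl_dim A B d" for d
  proof -
    from gd obtain V where V: "proper_variety (params A B) V"
      "\<forall>A' B'. sym_realization A A' \<and> realization B B' \<and> param_vec A B A' B' \<notin> V \<longrightarrow>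
        vec_space.rank (dim_row A) (ctrl_mat A' B') = d"
      unfolding is_generic_ctrl_dim_def by (elim exE conjE)
    show ?thesis
    proof (rule proper_variety_nonzero[OF V(1)])
      fix F a assume F: "polyfun (params A B) F" "F a \<noteq> 0"
        "\<And>x. x \<in> coord_space (params A B) \<Longrightarrow> F x \<noteq> 0 \<Longrightarrow> x \<notin> V"
      have "?rk x = d" if "F x \<noteq> 0" for x
      proof -
        have "restrict x (params A B) \<notin> V"
          by (rule F(3)) (simp_all add: polyfun_restrict[OF F(1)] that coord_space_def)
        then show ?thesis
          using V(2)[rule_format, of "mat_A x" "mat_B x"] realization_mat[of x] carrier_A by simp
      qed
      then show ?thesis using F(1,2) by (intro exI[of _ F] exI[of _ a]) simp
    qed
  qed
  obtain F a G b where F: "polyfun (params A B) F" "F a \<noteq> 0" "\<forall>x. F x \<noteq> 0 \<longrightarrow> ?rk x = d1"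
    and G: "polyfun (params A B) G" "G b \<noteq> 0" "\<forall>x. G x \<noteq> 0 \<longrightarrow> ?rk x = d2"
    using nonzero[OF assms(1)] nonzero[OF assms(2)] by (elim exE conjE)
  obtain x where "F x \<noteq> 0" "G x \<noteq> 0" using polyfun_common_nonzero[OF F(1,2) G(1,2)] by (elim exE conjE)
  then show ?thesis using F(3) G(3) by metis
qed

lemma is_generic_ctrl_dim_t_rank:
  assumes "irreducible_pair A B"
  shows "is_generic_ctrl_dim A B (t_rank (append_cols A B))"
proof -
  obtain N t \<tau> a where F1: "t_rank (append_cols A B) \<le> N" "\<forall>i<N. t i < n \<and> \<tau> i < n + m"
    "minor N (\<lambda>i j. wt a (t i) (\<tau> j)) \<noteq> 0"
    using exists_matching_minor by (elim exE conjE)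
  obtain r \<kappa> \<mu> c b where F2: "t_rank A \<le> r" "\<forall>l<r. 2 \<le> \<kappa> l \<and> \<mu> l \<in> inputs \<and> c l < n"
    "minor r (\<lambda>i l. walk verts (wt b) (\<kappa> l) (\<mu> l) (c i)) \<noteq> 0"
    using exists_krylov_minor[OF assms] by (elim exE conjE)
  let ?F = "\<lambda>x. minor N (\<lambda>i j. wt x (t i) (\<tau> j))"
  let ?G = "\<lambda>x. minor r (\<lambda>i l. walk verts (wt x) (\<kappa> l) (\<mu> l) (c i))"
  have F: "polyfun (params A B) ?F" by (intro polyfun_minor polyfun_wt)
  have G: "polyfun (params A B) ?G" by (intro polyfun_minor polyfun_walk)
  obtain y where y: "?F y \<noteq> 0" "?G y \<noteq> 0"
    using polyfun_common_nonzero[where F = ?F and a = a and G = ?G and b = b, OF F F1(3) G F2(3)]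
    by (elim exE conjE)
  have FG: "polyfun (params A B) (\<lambda>x. ?F x * ?G x)" by (rule polyfun_mult[OF F G])
  let ?V = "{x \<in> coord_space (params A B). ?F x * ?G x = 0}"
  have "proper_variety (params A B) ?V"
    by (rule proper_variety_polyfun[OF FG, of y]) (use y in simp)
  moreover have "vec_space.rank (dim_row A) (ctrl_mat A' B') = t_rank (append_cols A B)"
    if real: "sym_realization A A'" "realization B B'" and notin: "param_vec A B A' B' \<notin> ?V" for A' B'
  proof -
    let ?x = "param_vec A B A' B'"
    have "?x \<in> coord_space (params A B)" unfolding param_vec_def coord_space_def by simp
    then have nz: "?F ?x \<noteq> 0" "?G ?x \<noteq> 0" using notin by auto
    have "vec_space.rank n (ctrl_mat (mat_A ?x) (mat_B ?x)) = t_rank (append_cols A B)"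
      by (rule rank_ctrl_mat[OF nz(1) _ F1(1) nz(2) _ F2(1)]) (use F1(2) F2(2) in blast)+
    then show ?thesis
      unfolding realization_wt(1)[OF real, symmetric] realization_wt(2)[OF real, symmetric]
      using carrier_A by simp
  qed
  ultimately show ?thesis unfolding is_generic_ctrl_dim_def by blast
qed

end

theorem lemma4:
  fixes A B :: "entry mat" and n m :: nat
  assumes "A \<in> carrier_mat n n" and "B \<in> carrier_mat n m"
    and "sym_pattern A"
    and "irreducible_pair A B"
  shows "(\<exists>!d. is_generic_ctrl_dim A B d) \<and>
         generic_ctrl_dim A B = t_rank (append_cols A B)"
proof -
  interpret sym_pair A B n m using assms by unfold_locales
  have "\<exists>!d. is_generic_ctrl_dim A B d"
    using is_generic_ctrl_dim_t_rank[OF assms(4)] is_generic_ctrl_dim_unique by blast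
  then show ?thesis
    unfolding generic_ctrl_dim_def using is_generic_ctrl_dim_t_rank[OF assms(4)]
    by (auto intro: the1_equality)
qed

end
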